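(* Let $\alpha,m>0$, let $(\lambda_n)_{n\ge1}$ be an increasing sequence of positive numbers with $\lambda_n\to\infty$, and let $(d_n)_{n\ge1}$ be non-zero complex numbers with $\sum_{n\ge1}|d_n|\lambda_n^{-2/m}<\infty$. Let $W$ be the radial weight given by $$W(|z|^2)=\sum_{n\ge1}|d_n|\,e^{-\alpha\lambda_n|z|^m}.$$ Then the Korenblum radius $\mathcal K_W$ of $F^2_W$ satisfies $$\mathcal K_W^2=\alpha^{-2/m}\,\frac{\Gamma(4/m)}{\Gamma(2/m)}\,\frac{\sum_n|d_n|\lambda_n^{-4/m}}{\sum_n|d_n|\lambda_n^{-2/m}},$$ and the radius $\mathcal K_W$ is admissible for $F^2_W$. Moreover, $\mathcal K_W$ is strictly smaller than the Korenblum radius of $F^2_{W_1}$, where $W_1(|z|^2)=|d_1|e^{-\alpha\lambda_1|z|^m}$. In the special case $\lambda_n=n^m$, $d_n=1$ for all $n$, one has $\mathcal K_W=\frac{\pi}{\sqrt{15}}\,\mathcal K_{W_0}$, where $W_0(|z|^2)=e^{-\alpha|z|^m}$.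
   Context: A radial weight is a measurable function $W\ge0$ on $[0,\infty)$, not almost everywhere zero, whose moments $\int_0^\infty t^kW(t)\,dt$, $k=0,1,2,\dots$, are all finite (for the weights here this holds for all $k$ under the summability hypothesis; the value of $W$ at $0$ is irrelevant). $F^2_W$ is the space of entire functions $f$ with $\|f\|_W^2=\frac1\pi\int_{\mathbb C}|f(z)|^2W(|z|^2)\,dA(z)<\infty$, where $dA$ is area measure on $\mathbb C$. A radius $R>0$ is admissible for $F^2_W$ if $\|f\|_W\le\|g\|_W$ for all $f,g\in F^2_W$ with $|f(z)|\le|g(z)|$ for $|z|>R$. The Korenblum radius $\mathcal K_W$ of $F^2_W$ is the supremum of the admissible radii. $\Gamma$ is the Gamma function. *)

theory Defs
  imports "HOL-Analysis.Analysis" "HOL-Complex_Analysis.Complex_Analysis"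
begin

definition radial_weight :: "(real \<Rightarrow> real) \<Rightarrow> bool" where
  "radial_weight W \<longleftrightarrow>
     W \<in> borel_measurable (lebesgue_on {0..}) \<and>
     (\<forall>t\<ge>0. 0 \<le> W t) \<and>
     \<not> (AE t in lebesgue_on {0..}. W t = 0) \<and>
     (\<forall>k::nat. set_integrable lebesgue {0..} (\<lambda>t. t ^ k * W t))"

definition fock_space :: "(real \<Rightarrow> real) \<Rightarrow> (complex \<Rightarrow> complex) set" where
  "fock_space W =
     {f. f holomorphic_on UNIV \<and>
         integrable lebesgue (\<lambda>z. (cmod (f z))\<^sup>2 * W ((cmod z)\<^sup>2))}"

definition fock_norm :: "(real \<Rightarrow> real) \<Rightarrow> (complex \<Rightarrow> complex) \<Rightarrow> real" where
  "fock_norm W f =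
     sqrt (1 / pi * (\<integral>z. (cmod (f z))\<^sup>2 * W ((cmod z)\<^sup>2) \<partial>lebesgue))"

definition admissible_radius :: "(real \<Rightarrow> real) \<Rightarrow> real \<Rightarrow> bool" where
  "admissible_radius W R \<longleftrightarrow>
     R > 0 \<and>
     (\<forall>f\<in>fock_space W. \<forall>g\<in>fock_space W.
        (\<forall>z. cmod z > R \<longrightarrow> cmod (f z) \<le> cmod (g z)) \<longrightarrow> fock_norm W f \<le> fock_norm W g)"

(* The supremum is taken in [0, \<infinity>], so that it is also meaningful when the set of
   admissible radii is empty (supremum 0) or unbounded (supremum \<infinity>). *)
definition korenblum_radius :: "(real \<Rightarrow> real) \<Rightarrow> ennreal" where
  "korenblum_radius W = (SUP R\<in>{R. admissible_radius W R}. ennreal R)"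

end

(* Let mu_k be the moments of W. By rotation invariance and Parseval, the norm of f = sum of f_k z^k
   satisfies ||f||^2 = sum of mu_k |f_k|^2. Testing the constant R against z shows that an admissible
   R has R^2 <= mu_1 / mu_0. Conversely, R^2 = mu_1 / mu_0 is admissible for every radial weight:
   if |f| <= |g| for |z| > R, then f = phi g there, with phi holomorphic, |phi| <= 1, and phi also
   holomorphic at infinity. On a circle of radius r > R, multiplication by phi does not raise
   frequencies, so the part of f of frequencies >= N is the projection of phi times the
   corresponding part of g; hence
   sum_{k >= N} |f_k|^2 r^(2k) <= sum_{k >= N} |g_k|^2 r^(2k) for every N.
   Let r tend to R. As mu_k / R^(2k) is nondecreasing by log-convexity of the moments, summation by
   parts gives ||f|| <= ||g||. The moments of a sum of exponentials come from the Gamma integral;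
   the special case uses zeta(4), read off from
   prod (1 - x^4/k^4) = sin(pi x) sinh(pi x) / (pi x)^2. *)
theory Submission
  imports Defs "HOL-Real_Asymp.Real_Asymp"
begin

section \<open>Area measure in the complex plane\<close>

text \<open>Nothing is known about f and g inside the disc, so they can be compared only on circles
  |z| = r > R. The plain inequality of mean squares there is the case N = 0, which is too weak
  because the weights mu_k / R^(2k) may grow with k. The tail inequalities for all N are what a
  comparison with arbitrary nondecreasing weights needs. They rest on the boundedness of phi at
  infinity: its Laurent expansion contains only the powers z^(-j) with j >= 0, so the part of g of
  frequencies below N cannot contribute to the frequencies of f from N on. The ratio mu_1 / mu_0
  decides because it is the smallest of the ratios mu_(k+1) / mu_k. The testing pair R and z has phi
  = R / z, a pure shift by one frequency, applied at the lowest place. W is a function of t = |z|^2,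
  so |z|^m = t^p with p = m / 2, and the Gamma arguments 2/m and 4/m are (k + 1) / p for k = 0 and k
  = 1.\<close>

definition real2_of_complex :: "complex \<Rightarrow> real^2" where
  "real2_of_complex z = vector [Re z, Im z]"

definition complex_of_real2 :: "real^2 \<Rightarrow> complex" where
  "complex_of_real2 v = Complex (v $ 1) (v $ 2)"

lemma complex_of_real2_inverse [simp]:
  "complex_of_real2 (real2_of_complex z) = z" "real2_of_complex (complex_of_real2 v) = v"
  by (auto simp: complex_of_real2_def real2_of_complex_def vec_eq_iff forall_2)

lemma complex_of_real2_measurable [measurable]: "complex_of_real2 \<in> borel_measurable borel"
  unfolding complex_of_real2_def
  by (intro borel_measurable_continuous_onI) (auto simp: Complex_eq intro!: continuous_intros)

lemma vimage_complex_of_real2_box: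
  "complex_of_real2 -` box l u = box (real2_of_complex l) (real2_of_complex u)"
  by (auto simp: box_def Basis_complex_def mem_box_cart complex_of_real2_def real2_of_complex_def
      forall_2 Basis_vec_def inner_axis)

lemma emeasure_box_real2_of_complex:
  assumes "\<And>b. b \<in> Basis \<Longrightarrow> l \<bullet> b \<le> u \<bullet> b"
  shows "emeasure lborel (box (real2_of_complex l) (real2_of_complex u)) = (\<Prod>b\<in>Basis. (u - l) \<bullet> b)"
proof -
  have le: "Re l \<le> Re u" "Im l \<le> Im u"
    using assms[of 1] assms[of \<i>] by (auto simp: Basis_complex_def)
  have B: "(Basis :: (real^2) set) = {axis 1 1, axis 2 1}"
    by (auto simp: Basis_vec_def) (metis exhaust_2)
  have ne: "axis 1 1 \<noteq> (axis 2 1 :: real^2)"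
    by (simp add: axis_eq_axis)
  show ?thesis
    using le ne by (subst emeasure_lborel_box)
      (auto simp: B Basis_complex_def inner_axis real2_of_complex_def)
qed

text \<open>Agreement on boxes determines the measure. The transport makes invariance under
  orthogonal maps of \<open>real^2\<close> usable for rotations of the complex plane.\<close>

lemma lborel_complex_eq_distr_real2:
  "(lborel :: complex measure) = distr lborel borel complex_of_real2"
  by (rule lborel_eqI)
     (auto simp: emeasure_distr vimage_complex_of_real2_box emeasure_box_real2_of_complex)

text \<open>The preimage of a box under multiplication by \<open>c\<close> corresponds to the image
  of a box in \<open>real^2\<close> under an orthogonal map, which preserves measure.\<close>

lemma distr_lborel_rotation:
  fixes c :: complex
  assumes c: "cmod c = 1"
  shows "distr lborel borel ((*) c) = lborel"
proof (rule lborel_eqI[symmetric])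
  let ?T = "complex_of_real2"
  \<comment> \<open>Since |c| = 1, \<open>cnj c\<close> is the inverse of \<open>c\<close>:
    \<open>S\<close> is the inverse rotation, and preimages under the rotation become images under
    \<open>S\<close>.\<close>
  define S where "S v = real2_of_complex (cnj c * ?T v)" for v
  have cc: "c * cnj c = 1"
    using c by (simp add: complex_norm_square[symmetric])
  have lin: "linear S"
    by (rule linearI) (auto simp: S_def complex_of_real2_def real2_of_complex_def vec_eq_iff forall_2 algebra_simps)
  have nrm: "norm v = cmod (?T v)" for v
    by (simp add: norm_vec_def L2_set_def sum_2 cmod_def complex_of_real2_def)
  have orth: "orthogonal_transformation S"
    unfolding orthogonal_transformation using lin c by (simp add: nrm S_def norm_mult)
  fix l u :: complex assume le: "\<And>b. b \<in> Basis \<Longrightarrow> l \<bullet> b \<le> u \<bullet> b"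
  define Q where "Q = box (real2_of_complex l) (real2_of_complex u)"
  have Q: "Q = ?T -` box l u"
    by (simp add: Q_def vimage_complex_of_real2_box)
  have v2: "?T -` ((*) c -` box l u) = S ` Q"
  proof (intro equalityI subsetI)
    fix x assume x: "x \<in> ?T -` ((*) c -` box l u)"
    have "S (real2_of_complex (c * ?T x)) = x"
      unfolding S_def using cc by (simp add: mult.assoc[symmetric] mult.commute)
    moreover have "real2_of_complex (c * ?T x) \<in> Q" using x by (simp add: Q)
    ultimately show "x \<in> S ` Q" by (metis imageI)
  next
    fix x assume "x \<in> S ` Q"
    then obtain y where y: "x = S y" "y \<in> Q" by auto
    have "c * ?T x = ?T y"
      unfolding y(1) S_def using cc by (simp add: mult.assoc[symmetric])
    then show "x \<in> ?T -` ((*) c -` box l u)" using y(2) by (simp add: Q)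
  qed
  have pre: "(*) c -` box l u \<in> sets borel"
    by (rule measurable_sets_borel[of _ borel]) auto
  have "emeasure (distr lborel borel ((*) c)) (box l u) = emeasure lborel ((*) c -` box l u)"
    by (subst emeasure_distr) auto
  also have "\<dots> = emeasure lborel (S ` Q)"
    using pre by (subst lborel_complex_eq_distr_real2, subst emeasure_distr) (auto simp: v2)
  also have "\<dots> = emeasure lebesgue (S ` Q)"
    using measurable_sets_borel[OF complex_of_real2_measurable pre] by (simp add: v2)
  also have "\<dots> = measure lebesgue (S ` Q)"
    using measurable_orthogonal_image[OF orth, of Q]
    by (simp add: emeasure_eq_measure2 lmeasurable_box Q_def)
  also have "\<dots> = measure lebesgue Q"
    by (simp add: measure_orthogonal_image[OF orth] lmeasurable_box Q_def)
  also have "\<dots> = emeasure lebesgue Q"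
    by (simp add: emeasure_eq_measure2 lmeasurable_box Q_def)
  also have "\<dots> = (\<Prod>b\<in>Basis. (u - l) \<bullet> b)"
    using emeasure_box_real2_of_complex[OF le] by (simp add: Q_def)
  finally show "emeasure (distr lborel borel ((*) c)) (box l u) = (\<Prod>b\<in>Basis. (u - l) \<bullet> b)" .
qed auto

text \<open>This replaces polar coordinates: the half-line below \<open>x\<close> pulls back to the
  disc of radius \<open>sqrt x\<close>, whose area is linear in \<open>x\<close>. For negative
  \<open>x\<close> both measures give 0, which is also the value of
  \<open>ennreal x\<close>.\<close>

lemma distr_lborel_cmod_square:
  "distr lborel borel (\<lambda>z::complex. (cmod z)\<^sup>2) = density lborel (\<lambda>t. ennreal pi * indicator {0..} t)"
proof (rule measure_eqI_generator_eq_countable)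
  let ?M = "distr lborel borel (\<lambda>z::complex. (cmod z)\<^sup>2)"
  let ?N = "density lborel (\<lambda>t::real. ennreal pi * indicator {0..} t)"
  let ?E = "range (lessThan :: real \<Rightarrow> real set)"
  have M: "emeasure ?M {..<x} = ennreal pi * ennreal x" for x
  proof -
    have "emeasure ?M {..<x} = emeasure lborel (ball (0::complex) (sqrt x))"
    proof (cases "x > 0")
      case True
      have "(\<lambda>z::complex. (cmod z)\<^sup>2) -` {..<x} = ball 0 (sqrt x)"
        using True by (auto simp: dist_norm real_less_rsqrt) (metis norm_ge_zero real_sqrt_less_mono real_sqrt_unique real_sqrt_pow2 less_imp_le power_strict_mono zero_less_numeral)
      then show ?thesis by (subst emeasure_distr) auto
    next
      case False
      then have "(\<lambda>z::complex. (cmod z)\<^sup>2) -` {..<x} = {}" 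
        by (auto simp: not_less) (meson not_le order_trans zero_le_power2)
      moreover have e: "ball (0::complex) (sqrt x) = {}" using False by auto
      ultimately show ?thesis unfolding e by (subst emeasure_distr) auto
    qed
    also have "\<dots> = ennreal pi * ennreal x"
    proof (cases "x \<ge> 0")
      case True
      then show ?thesis
        by (simp add: emeasure_ball unit_ball_vol_2 power2_eq_square flip: ennreal_mult')
    next
      case False
      then show ?thesis by (simp add: ennreal_neg ball_empty)
    qed
    finally show ?thesis .
  qed
  have N: "emeasure ?N {..<x} = ennreal pi * ennreal x" for x
  proof -
    have "emeasure ?N {..<x} = (\<integral>\<^sup>+t. ennreal pi * indicator {0..<x} t \<partial>lborel)"
      by (subst emeasure_density) (auto intro!: nn_integral_cong simp: indicator_def)
    also have "\<dots> = ennreal pi * ennreal x"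
      by (cases "x \<ge> 0") (simp_all add: nn_integral_cmult_indicator ennreal_neg emeasure_lborel_Ico)
    finally show ?thesis .
  qed
  show "Int_stable ?E"
    unfolding Int_stable_def
  proof clarify
    fix a b :: real
    have "{..<a} \<inter> {..<b} = {..<min a b}" by auto
    then show "{..<a} \<inter> {..<b} \<in> ?E" by simp
  qed
  show "?E \<subseteq> Pow UNIV" by auto
  show "emeasure ?M X = emeasure ?N X" if "X \<in> ?E" for X
    using that M N by auto
  show "sets ?M = sigma_sets UNIV ?E" "sets ?N = sigma_sets UNIV ?E"
    by (simp_all add: borel_Iio)
  let ?A = "range (\<lambda>n::nat. {..<real n})"
  show "?A \<subseteq> ?E" by auto
  show "\<Union>?A = UNIV" using reals_Archimedean2 by auto
  show "countable ?A" by auto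
  show "emeasure ?M a \<noteq> \<infinity>" if "a \<in> ?A" for a
    using that by (auto simp: M ennreal_mult_eq_top_iff)
qed

lemma nn_integral_cmod_square:
  assumes [measurable]: "V \<in> borel_measurable borel"
  shows "(\<integral>\<^sup>+z. V ((cmod z)\<^sup>2) \<partial>lborel) = ennreal pi * (\<integral>\<^sup>+t. indicator {0..} t * V t \<partial>lborel)"
proof -
  have "(\<integral>\<^sup>+z. V ((cmod z)\<^sup>2) \<partial>lborel) = integral\<^sup>N (distr lborel borel (\<lambda>z::complex. (cmod z)\<^sup>2)) V"
    by (subst nn_integral_distr) auto
  also have "\<dots> = (\<integral>\<^sup>+t. ennreal pi * (indicator {0..} t * V t) \<partial>lborel)"
    unfolding distr_lborel_cmod_square by (subst nn_integral_density) (auto simp: mult.assoc)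
  also have "\<dots> = ennreal pi * (\<integral>\<^sup>+t. indicator {0..} t * V t \<partial>lborel)"
    by (subst nn_integral_cmult) auto
  finally show ?thesis .
qed

text \<open>A null set of squared radii pulls back to a null set of the plane. This allows a weight
  to be modified on a null set before it is composed with \<open>(cmod z)\<^sup>2\<close>.\<close>

lemma AE_cmod_square:
  assumes "AE t in lborel. P t"
  shows "AE z in lborel. P ((cmod z)\<^sup>2)"
proof -
  obtain N where N: "N \<in> null_sets lborel" "{t. \<not> P t} \<subseteq> N"
    using assms by (auto elim!: AE_E simp: null_sets_def)
  have [measurable]: "N \<in> sets borel" using N by auto
  have pre: "(\<lambda>z::complex. (cmod z)\<^sup>2) -` N \<in> sets borel"
    by (rule measurable_sets_borel[of _ borel]) auto
  have "emeasure lborel ((\<lambda>z::complex. (cmod z)\<^sup>2) -` N) = (\<integral>\<^sup>+z. indicator N ((cmod z)\<^sup>2) \<partial>lborel)"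
    using pre by (subst nn_integral_indicator[symmetric], simp, intro nn_integral_cong) (simp add: indicator_def)
  also have "\<dots> = ennreal pi * (\<integral>\<^sup>+t. indicator {0..} t * indicator N t \<partial>lborel)"
    by (rule nn_integral_cmod_square) auto
  also have "(\<integral>\<^sup>+t. indicator {0..} t * indicator N t \<partial>lborel) \<le> (\<integral>\<^sup>+t. indicator N t \<partial>lborel)"
    by (intro nn_integral_mono) (auto simp: indicator_def)
  also have "\<dots> = 0" using N by (auto simp: null_sets_def)
  finally have "emeasure lborel ((\<lambda>z::complex. (cmod z)\<^sup>2) -` N) = 0" by (simp add: mult_left_mono)
  then have "(\<lambda>z::complex. (cmod z)\<^sup>2) -` N \<in> null_sets lborel"
    using pre by (auto simp: null_sets_def)
  then show ?thesis
    by (rule AE_I') (use N in auto)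
qed

section \<open>Means over the unit circle\<close>

text \<open>The parameter runs over [0, 1], so that integrals over it are means, without a factor 1
  / (2 pi).\<close>

definition circ :: "real \<Rightarrow> complex" where
  "circ t = exp (2 * of_real pi * \<i> * of_real t)"

lemma norm_circ [simp]: "cmod (circ t) = 1"
  by (simp add: circ_def)

lemma circ_ne_0 [simp]: "circ t \<noteq> 0"
  by (simp add: circ_def)

lemma continuous_on_circ [continuous_intros]:
  "continuous_on A circ"
  unfolding circ_def by (intro continuous_intros)

lemma has_integral_mean_value:
  assumes A: "A holomorphic_on ball 0 \<rho>" and \<rho>: "\<rho> > 1"
  shows "((\<lambda>t. A (circ t)) has_integral A 0) {0..1}"
proof -
  have "((\<lambda>u. A u / (u - 0)) has_contour_integral 2 * of_real pi * \<i> * A 0) (circlepath 0 1)"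
    by (rule Cauchy_integral_circlepath_simple) (use \<rho> in \<open>auto intro!: holomorphic_on_subset[OF A]\<close>)
  then have "((\<lambda>t. A (circ t) / circ t * (2 * of_real pi * \<i> * circ t)) has_integral 2 * of_real pi * \<i> * A 0) {0..1}"
    unfolding has_contour_integral vector_derivative_circlepath
    by (simp add: circlepath circ_def)
  then have "((\<lambda>t. (2 * of_real pi * \<i>) * A (circ t)) has_integral (2 * of_real pi * \<i>) * A 0) {0..1}"
    by (simp add: algebra_simps)
  from has_integral_mult_right[OF this, of "inverse (2 * of_real pi * \<i>)"]
  show ?thesis by (simp add: field_simps)
qed

text \<open>The map z to \<open>cnj (H (cnj z))\<close> is again holomorphic, so the integrand is
  the restriction of a holomorphic function vanishing at 0, and the mean value property applies. In
  Fourier terms \<open>F\<close> has frequencies >= 0 on the circle and \<open>H (cnj z)\<close>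
  only negative ones.\<close>

lemma circle_mean_orthogonal:
  assumes F: "F holomorphic_on ball 0 \<rho>" and H: "H holomorphic_on ball 0 \<rho>" and \<rho>: "\<rho> > 1"
    and H0: "H 0 = 0"
  shows "((\<lambda>t. F (circ t) * cnj (H (cnj (circ t)))) has_integral 0) {0..1}"
proof -
  have "cnj ` ball 0 \<rho> = ball 0 \<rho>"
    by (auto simp: image_iff intro!: bexI[of _ "cnj _"])
  then have "(cnj \<circ> H \<circ> cnj) holomorphic_on ball 0 \<rho>"
    using H by (intro holomorphic_on_compose_cnj_cnj) auto
  then have "(\<lambda>z. F z * (cnj \<circ> H \<circ> cnj) z) holomorphic_on ball 0 \<rho>"
    using F by (intro holomorphic_intros)
  from has_integral_mean_value[OF this \<rho>] show ?thesis using H0 by simp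
qed

definition circle_mean :: "(complex \<Rightarrow> real) \<Rightarrow> real" where
  "circle_mean f = integral {0..1} (\<lambda>t. f (circ t))"

lemma circle_mean_integrable:
  fixes f :: "complex \<Rightarrow> real"
  assumes "continuous_on (sphere 0 1) f"
  shows "(\<lambda>t. f (circ t)) integrable_on {0..1::real}"
  by (intro integrable_continuous_real continuous_on_compose2[OF assms] continuous_intros) auto

lemma circle_mean_mono:
  assumes "continuous_on (sphere 0 1) f" "continuous_on (sphere 0 1) g"
    and "\<And>z. cmod z = 1 \<Longrightarrow> f z \<le> g z"
  shows "circle_mean f \<le> circle_mean g"
  unfolding circle_mean_def
  using assms by (intro integral_le circle_mean_integrable) auto

lemma circle_mean_cong:
  assumes "\<And>z. cmod z = 1 \<Longrightarrow> f z = g z"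
  shows "circle_mean f = circle_mean g"
  unfolding circle_mean_def using assms by (intro integral_cong) auto

lemma circle_mean_const [simp]: "circle_mean (\<lambda>_. c) = c"
  by (simp add: circle_mean_def)

lemma circle_mean_pythagoras:
  assumes F: "F holomorphic_on ball 0 \<rho>" and H: "H holomorphic_on ball 0 \<rho>" and \<rho>: "\<rho> > 1"
    and H0: "H 0 = 0"
  shows "circle_mean (\<lambda>z. (cmod (F z + H (cnj z)))\<^sup>2) =
    circle_mean (\<lambda>z. (cmod (F z))\<^sup>2) + circle_mean (\<lambda>z. (cmod (H (cnj z)))\<^sup>2)"
proof -
  have cF: "continuous_on (sphere 0 1) F"
    using holomorphic_on_imp_continuous_on[OF F] by (rule continuous_on_subset) (use \<rho> in auto)
  have cH: "continuous_on (sphere 0 1) (\<lambda>z. H (cnj z))"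
    by (intro continuous_on_compose2[OF holomorphic_on_imp_continuous_on[OF H]] continuous_intros)
       (use \<rho> in auto)
  have "((\<lambda>t. Re (F (circ t) * cnj (H (cnj (circ t))))) has_integral 0) {0..1}"
    using has_integral_Re[OF circle_mean_orthogonal[OF assms]] by simp
  from has_integral_mult_right[OF this, of 2]
  have I: "((\<lambda>t. 2 * Re (F (circ t) * cnj (H (cnj (circ t))))) has_integral 0) {0..1}" by simp
  have "((\<lambda>t. (cmod (F (circ t)))\<^sup>2 + (cmod (H (cnj (circ t))))\<^sup>2 + 2 * Re (F (circ t) * cnj (H (cnj (circ t)))))
     has_integral circle_mean (\<lambda>z. (cmod (F z))\<^sup>2) + circle_mean (\<lambda>z. (cmod (H (cnj z)))\<^sup>2) + 0) {0..1}"
    unfolding circle_mean_def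
    by (intro has_integral_add[OF has_integral_add I] integrable_integral
        circle_mean_integrable[of "\<lambda>z. (cmod (F z))\<^sup>2"] circle_mean_integrable[of "\<lambda>z. (cmod (H (cnj z)))\<^sup>2"]
        continuous_intros cF cH)
  moreover have "(cmod (a + b))\<^sup>2 = (cmod a)\<^sup>2 + (cmod b)\<^sup>2 + 2 * Re (a * cnj b)" for a b
    unfolding cmod_power2 by (simp add: power2_eq_square algebra_simps)
  ultimately show ?thesis
    unfolding circle_mean_def by (simp add: integral_unique)
qed

section \<open>Entire power series and Parseval's identity on the unit circle\<close>

definition powser :: "(nat \<Rightarrow> complex) \<Rightarrow> complex \<Rightarrow> complex" where
  "powser a z = (\<Sum>n. a n * z ^ n)"

definition entire_coeffs :: "(nat \<Rightarrow> complex) \<Rightarrow> bool" where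
  "entire_coeffs a \<longleftrightarrow> (\<forall>z. summable (\<lambda>n. a n * z ^ n))"

lemma powser_sums: "entire_coeffs a \<Longrightarrow> (\<lambda>n. a n * z ^ n) sums powser a z"
  by (simp add: powser_def entire_coeffs_def summable_sums)

lemma powser_abs_summable:
  assumes "entire_coeffs a"
  shows "summable (\<lambda>n. cmod (a n) * x ^ n)"
proof -
  have "summable (\<lambda>n. a n * of_real (\<bar>x\<bar> + 1) ^ n)" 
    using assms by (auto simp: entire_coeffs_def)
  then have "summable (\<lambda>n. norm (a n * of_real x ^ n))"
    by (rule powser_insidea) auto
  then have "summable (\<lambda>n. norm (cmod (a n) * x ^ n))"
    by (simp add: norm_mult norm_power abs_mult power_abs)
  then show ?thesis by (rule summable_norm_cancel)
qed

lemma powser_holomorphic: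
  assumes "entire_coeffs a"
  shows "powser a holomorphic_on A"
proof -
  have "powser a holomorphic_on ball 0 (cmod z + 1)" for z
    by (rule power_series_holomorphic) (use powser_sums[OF assms] in auto)
  then have "powser a field_differentiable at z" for z
    by (rule holomorphic_on_imp_differentiable_at[of _ "ball 0 (cmod z + 1)"]) auto
  then show ?thesis
    by (auto simp: holomorphic_on_def field_differentiable_at_within)
qed

lemma entire_coeffs_Suc:
  assumes "entire_coeffs a"
  shows "entire_coeffs (\<lambda>n. a (Suc n))"
  unfolding entire_coeffs_def
proof
  fix z
  show "summable (\<lambda>n. a (Suc n) * z ^ n)"
  proof (cases "z = 0")
    case False
    have "summable (\<lambda>n. a (Suc n) * z ^ Suc n)"
      using assms unfolding entire_coeffs_def by (subst summable_Suc_iff) auto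
    from summable_mult[OF this, of "inverse z"] False show ?thesis
      by (simp add: field_simps)
  qed (auto intro: summable_0_powser)
qed

lemma entire_coeffs_shift:
  assumes "entire_coeffs a"
  shows "entire_coeffs (\<lambda>n. a (n + N))"
  by (induction N) (use assms entire_coeffs_Suc in \<open>auto dest: entire_coeffs_Suc\<close>)

lemma powser_Suc:
  assumes "entire_coeffs a"
  shows "powser a z = a 0 + z * powser (\<lambda>n. a (Suc n)) z"
proof -
  have "(\<lambda>n. z * (a (Suc n) * z ^ n)) sums (z * powser (\<lambda>n. a (Suc n)) z)"
    by (intro sums_mult powser_sums entire_coeffs_Suc assms)
  then have "(\<lambda>n. a (Suc n) * z ^ Suc n) sums (z * powser (\<lambda>n. a (Suc n)) z)"
    by (simp add: mult_ac)
  then have "(\<lambda>n. a n * z ^ n) sums (z * powser (\<lambda>n. a (Suc n)) z + a 0 * z ^ 0)"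
    by (rule sums_Suc)
  then show ?thesis using powser_sums[OF assms, of z] sums_unique2 by fastforce
qed

lemma powser_split:
  assumes "entire_coeffs a"
  shows "powser a z = (\<Sum>k<N. a k * z ^ k) + z ^ N * powser (\<lambda>n. a (n + N)) z"
proof (induction N)
  case (Suc N)
  show ?case
    using powser_Suc[OF entire_coeffs_shift[OF assms, of N], of z] Suc
    by (simp add: algebra_simps)
qed simp

text \<open>Multiplication by \<open>cnj z\<close> preserves the modulus on the circle and lowers
  every frequency by one; the term \<open>a 0\<close> then has frequency -1 and is orthogonal to the
  rest.\<close>

lemma circle_mean_powser_Suc:
  assumes a: "entire_coeffs a"
  shows "circle_mean (\<lambda>z. (cmod (powser a z))\<^sup>2) =
     (cmod (a 0))\<^sup>2 + circle_mean (\<lambda>z. (cmod (powser (\<lambda>n. a (Suc n)) z))\<^sup>2)"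
proof -
  let ?F = "powser (\<lambda>n. a (Suc n))"
  have "circle_mean (\<lambda>z. (cmod (powser a z))\<^sup>2) = circle_mean (\<lambda>z. (cmod (?F z + a 0 * cnj z))\<^sup>2)"
  proof (rule circle_mean_cong)
    fix z :: complex assume z: "cmod z = 1"
    then have zz: "cnj z * z = 1"
      by (simp add: complex_norm_square[symmetric] mult.commute)
    have "?F z + a 0 * cnj z = cnj z * powser a z"
      unfolding powser_Suc[OF a, of z] using zz by (simp add: algebra_simps flip: mult.assoc)
    then show "(cmod (powser a z))\<^sup>2 = (cmod (?F z + a 0 * cnj z))\<^sup>2" using z by (simp add: norm_mult)
  qed
  also have "\<dots> = circle_mean (\<lambda>z. (cmod (?F z))\<^sup>2) + circle_mean (\<lambda>z. (cmod (a 0 * cnj z))\<^sup>2)"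
    by (rule circle_mean_pythagoras[where \<rho> = 2])
       (auto intro!: powser_holomorphic entire_coeffs_Suc a holomorphic_intros)
  also have "circle_mean (\<lambda>z. (cmod (a 0 * cnj z))\<^sup>2) = circle_mean (\<lambda>z. (cmod (a 0))\<^sup>2)"
    by (rule circle_mean_cong) (simp add: norm_mult)
  finally show ?thesis by simp
qed

text \<open>Splitting off one coefficient at a time telescopes. The remainder is the mean square of
  a shifted series, bounded by the square of a tail of the convergent series of the |a_k|, so it
  tends to 0.\<close>

lemma parseval:
  assumes a: "entire_coeffs a"
  shows "(\<lambda>n. (cmod (a n))\<^sup>2) sums circle_mean (\<lambda>z. (cmod (powser a z))\<^sup>2)"
proof -
  let ?M = "\<lambda>N. circle_mean (\<lambda>z. (cmod (powser (\<lambda>n. a (n + N)) z))\<^sup>2)"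
  have eq: "(\<Sum>k<N. (cmod (a k))\<^sup>2) = ?M 0 - ?M N" for N
  proof (induction N)
    case (Suc N)
    show ?case using circle_mean_powser_Suc[OF entire_coeffs_shift[OF a, of N]] Suc by simp
  qed simp
  define S where "S N = (\<Sum>k. cmod (a (k + N)))" for N
  have sum: "summable (\<lambda>k. cmod (a k))"
    using powser_abs_summable[OF a, of 1] by simp
  have S: "S \<longlonglongrightarrow> 0"
    unfolding S_def using sum by (rule suminf_exist_split2)
  have M: "?M N \<le> (S N)\<^sup>2" for N
  proof -
    have "?M N \<le> circle_mean (\<lambda>_. (S N)\<^sup>2)"
    proof (rule circle_mean_mono)
      show "continuous_on (sphere 0 1) (\<lambda>z. (cmod (powser (\<lambda>n. a (n + N)) z))\<^sup>2)"
        by (intro continuous_intros holomorphic_on_imp_continuous_on powser_holomorphic entire_coeffs_shift a)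
      fix z :: complex assume z: "cmod z = 1"
      have "cmod (powser (\<lambda>n. a (n + N)) z) \<le> S N"
        unfolding powser_def S_def
        by (rule order_trans[OF summable_norm])
           (use sum z in \<open>auto simp: norm_mult norm_power intro: summable_ignore_initial_segment\<close>)
      then show "(cmod (powser (\<lambda>n. a (n + N)) z))\<^sup>2 \<le> (S N)\<^sup>2"
        by (intro power_mono) auto
    qed auto
    then show ?thesis by simp
  qed
  have M0: "0 \<le> ?M N" for N
    by (rule order_trans[of _ "circle_mean (\<lambda>_. 0)"], simp, rule circle_mean_mono)
       (auto intro!: continuous_intros holomorphic_on_imp_continuous_on powser_holomorphic entire_coeffs_shift a)
  have "(\<lambda>N. (S N)\<^sup>2) \<longlonglongrightarrow> 0" using tendsto_power[OF S, of 2] by simp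
  then have "?M \<longlonglongrightarrow> 0"
    by (rule tendsto_sandwich[OF _ _ tendsto_const[of 0], rotated -1]) (auto simp: M M0 always_eventually)
  then have "(\<lambda>N. ?M 0 - ?M N) \<longlonglongrightarrow> ?M 0 - 0" by (intro tendsto_intros)
  then show ?thesis unfolding sums_def eq by simp
qed

section \<open>Radial integrals of power series\<close>

lemma powser_measurable [measurable]:
  assumes "entire_coeffs a"
  shows "powser a \<in> borel_measurable borel"
  by (intro borel_measurable_continuous_onI holomorphic_on_imp_continuous_on powser_holomorphic assms)

lemma circ_measurable [measurable]: "circ \<in> borel_measurable borel"
  by (intro borel_measurable_continuous_onI continuous_on_circ)

lemma entire_coeffs_scale:
  assumes a: "entire_coeffs a"
  shows "entire_coeffs (\<lambda>n. a n * z ^ n)"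
  unfolding entire_coeffs_def
proof
  fix w
  have "summable (\<lambda>n. a n * (z * w) ^ n)" using a unfolding entire_coeffs_def by blast
  then show "summable (\<lambda>n. a n * z ^ n * w ^ n)"
    by (simp add: power_mult_distrib mult.assoc)
qed

lemma powser_scale: "powser (\<lambda>n. a n * z ^ n) u = powser a (u * z)"
  by (simp add: powser_def power_mult_distrib mult_ac)

text \<open>This is Parseval on the circle of radius |z|, obtained on the unit circle for the
  coefficients \<open>a n * z ^ n\<close>.\<close>

lemma nn_integral_circ_powser:
  assumes a: "entire_coeffs a"
  shows "(\<integral>\<^sup>+t. indicator {0..1} t * ennreal ((cmod (powser a (circ t * z)))\<^sup>2) \<partial>lborel) =
    (\<Sum>n. ennreal ((cmod (a n))\<^sup>2 * (cmod z)\<^sup>2 ^ n))"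
proof -
  define b where "b = (\<lambda>n. a n * z ^ n)"
  have b: "entire_coeffs b"
    unfolding b_def by (rule entire_coeffs_scale[OF a])
  have pb: "powser a (u * z) = powser b u" for u
    by (simp add: b_def powser_scale)
  have bn: "(cmod (b n))\<^sup>2 = (cmod (a n))\<^sup>2 * (cmod z)\<^sup>2 ^ n" for n
    by (simp add: b_def norm_mult norm_power power_mult_distrib power2_eq_square)
  have ind: "indicator {0..1} t * ennreal x = ennreal (indicator {0..1} t * x)" for t x :: real
    by (cases "t \<in> {0..1}") simp_all
  have "((\<lambda>t. (cmod (powser b (circ t)))\<^sup>2) has_integral circle_mean (\<lambda>z. (cmod (powser b z))\<^sup>2)) {0..1}"
    unfolding circle_mean_def
    by (intro integrable_integral circle_mean_integrable[where f = "\<lambda>z. (cmod (powser b z))\<^sup>2"]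
        continuous_intros holomorphic_on_imp_continuous_on powser_holomorphic b)
  from nn_integral_has_integral_lebesgue[OF _ this]
  have "(\<integral>\<^sup>+t. indicator {0..1} t * ennreal ((cmod (powser a (circ t * z)))\<^sup>2) \<partial>lborel)
      = ennreal (circle_mean (\<lambda>z. (cmod (powser b z))\<^sup>2))"
    by (simp only: pb ind) simp
  also have "\<dots> = (\<Sum>n. ennreal ((cmod (b n))\<^sup>2))"
    by (rule suminf_ennreal_eq[symmetric]) (simp_all add: parseval[OF b])
  finally show ?thesis by (simp only: bn)
qed

text \<open>The area integral equals each of its rotated versions, hence their average over the
  parameter t. Exchanging the two integrals puts a circle mean inside, where Parseval applies; only
  a radial integral remains. All terms are nonnegative, so no integrability has to be known
  beforehand.\<close>

lemma nn_integral_powser_radial: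
  assumes a: "entire_coeffs a" and V[measurable]: "V \<in> borel_measurable borel"
  shows "(\<integral>\<^sup>+z. ennreal ((cmod (powser a z))\<^sup>2) * V ((cmod z)\<^sup>2) \<partial>lborel) =
    ennreal pi * (\<Sum>n. ennreal ((cmod (a n))\<^sup>2) * (\<integral>\<^sup>+t. indicator {0..} t * (ennreal (t ^ n) * V t) \<partial>lborel))"
proof -
  note [measurable] = powser_measurable[OF a]
  define G where "G z = ennreal ((cmod (powser a z))\<^sup>2)" for z
  have [measurable]: "G \<in> borel_measurable borel" unfolding G_def by measurable
  define I where "I = (\<integral>\<^sup>+z. G z * V ((cmod z)\<^sup>2) \<partial>lborel)"
  have rot: "I = (\<integral>\<^sup>+z. G (circ t * z) * V ((cmod z)\<^sup>2) \<partial>lborel)" for t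
  proof -
    have "I = (\<integral>\<^sup>+z. G z * V ((cmod z)\<^sup>2) \<partial>distr lborel borel ((*) (circ t)))"
      by (simp add: I_def distr_lborel_rotation)
    then show ?thesis by (simp add: nn_integral_distr norm_mult)
  qed
  have "I = (\<integral>\<^sup>+t. I * indicator {0..1::real} t \<partial>lborel)"
    by (simp add: nn_integral_cmult_indicator)
  also have "\<dots> = (\<integral>\<^sup>+t. (\<integral>\<^sup>+z. indicator {0..1::real} t * (G (circ t * z) * V ((cmod z)\<^sup>2)) \<partial>lborel) \<partial>lborel)"
    by (intro nn_integral_cong) (subst nn_integral_cmult, measurable, subst rot[symmetric], rule mult.commute)
  also have "\<dots> = (\<integral>\<^sup>+z. (\<integral>\<^sup>+t. indicator {0..1::real} t * (G (circ t * z) * V ((cmod z)\<^sup>2)) \<partial>lborel) \<partial>lborel)"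
    by (rule lborel_pair.Fubini') measurable
  also have "\<dots> = (\<integral>\<^sup>+z. (\<integral>\<^sup>+t. indicator {0..1::real} t * G (circ t * z) \<partial>lborel) * V ((cmod z)\<^sup>2) \<partial>lborel)"
    by (intro nn_integral_cong, subst mult.assoc[symmetric], rule nn_integral_multc) measurable
  also have "\<dots> = (\<integral>\<^sup>+z. (\<Sum>n. ennreal ((cmod (a n))\<^sup>2) * (ennreal ((cmod z)\<^sup>2 ^ n) * V ((cmod z)\<^sup>2))) \<partial>lborel)"
    unfolding G_def nn_integral_circ_powser[OF a]
    by (intro nn_integral_cong, subst ennreal_suminf_multc[symmetric]) (simp add: ennreal_mult mult.assoc)
  also have "\<dots> = (\<Sum>n. ennreal ((cmod (a n))\<^sup>2) * (\<integral>\<^sup>+z. ennreal ((cmod z)\<^sup>2 ^ n) * V ((cmod z)\<^sup>2) \<partial>(lborel::complex measure)))"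
    by (subst nn_integral_suminf) (auto simp: nn_integral_cmult)
  also have "\<dots> = (\<Sum>n. ennreal pi * (ennreal ((cmod (a n))\<^sup>2) * (\<integral>\<^sup>+t. indicator {0..} t * (ennreal (t ^ n) * V t) \<partial>lborel)))"
    by (intro suminf_cong, subst nn_integral_cmod_square[where V = "\<lambda>t. ennreal (t ^ n) * V t" for n])
       (auto simp: mult_ac)
  finally show ?thesis
    by (simp add: I_def G_def)
qed

section \<open>Comparison of tails of coefficients\<close>

text \<open>The function \<open>\<psi>\<close> is the quotient f / g in the coordinate w = 1 / z.
  The product form of the conclusion stays meaningful at zeros of \<open>g\<close>.\<close>

lemma ex_reflected_quotient:
  assumes f: "f holomorphic_on UNIV" and g: "g holomorphic_on UNIV" and g0: "\<exists>z. g z \<noteq> 0"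
    and s: "s > 0" and le: "\<And>z. cmod z > s \<Longrightarrow> cmod (f z) \<le> cmod (g z)"
  obtains \<psi> where "\<psi> holomorphic_on ball 0 (1 / s)"
    and "\<And>w. w \<in> ball 0 (1 / s) - {0} \<Longrightarrow> cmod (\<psi> w) \<le> 1 \<and> \<psi> w * g (1 / w) = f (1 / w)"
proof -
  \<comment> \<open>One global function is needed, not a local extension near each point. Zeros of
    \<open>g\<close> are isolated because \<open>g\<close> is not identically zero, and the bound |f
    / g| <= 1 makes the quotient removable there.\<close>
  define \<phi> where "\<phi> = remove_sings (\<lambda>z. f z / g z)"
  have loc: "\<phi> analytic_on {z} \<and> cmod (\<phi> z) \<le> 1 \<and> \<phi> z * g z = f z" if z: "cmod z > s" for z
  proof -
    let ?q = "\<lambda>z. f z / g z"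
    obtain \<beta> where "g \<beta> \<noteq> 0" using g0 by auto
    then have ev: "\<forall>\<^sub>F w in at z. g w \<noteq> 0"
      using non_zero_neighbour_alt[OF g, of z \<beta>] connected_UNIV by simp
    have opn: "open {w::complex. s < cmod w}"
      by (intro open_Collect_less continuous_intros)
    have ev2: "\<forall>\<^sub>F w in at z. w \<in> {w. s < cmod w}"
      using opn z by (auto intro!: eventually_at_topological[THEN iffD2])
    have bd: "\<forall>\<^sub>F w in at z. cmod (?q w) \<le> 1"
      using ev ev2 by eventually_elim (use le in \<open>auto simp: norm_divide divide_le_eq\<close>)
    obtain e where e: "e > 0" "\<And>w. w \<noteq> z \<Longrightarrow> dist w z < e \<Longrightarrow> g w \<noteq> 0"
      using ev unfolding eventually_at by auto
    have hol: "?q holomorphic_on ball z e - {z}"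
      by (intro holomorphic_intros holomorphic_on_subset[OF f] holomorphic_on_subset[OF g])
         (use e in \<open>auto simp: dist_commute\<close>)
    have "\<exists>h. h holomorphic_on ball z e \<and> (\<forall>w\<in>ball z e - {z}. h w = ?q w)"
      using holomorphic_on_extend_bounded[OF hol] e(1) bd by auto
    then obtain h where h: "h holomorphic_on ball z e" "\<And>w. w \<in> ball z e - {z} \<Longrightarrow> h w = ?q w"
      by blast
    have hc: "h \<midarrow>z\<rightarrow> h z"
      using holomorphic_on_imp_continuous_on[OF h(1)] e(1)
      by (simp add: continuous_on_eq_continuous_at isCont_def)
    have evh: "\<forall>\<^sub>F w in at z. h w = ?q w"
      using eventually_at_in_open[of "ball z e" z] e(1) h(2) by (auto elim: eventually_mono)
    have qc: "?q \<midarrow>z\<rightarrow> h z"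
      using tendsto_cong[OF evh] hc by simp
    have eq: "\<phi> z = h z"
      unfolding \<phi>_def by (rule remove_sings_eqI) fact
    have qa: "?q analytic_on ball z e - {z}"
      using hol by (subst analytic_on_open) (auto intro: open_delete)
    have an: "\<phi> analytic_on {z}"
      unfolding \<phi>_def
      by (rule remove_sings_analytic_at[OF _ qc])
         (use e(1) qa in \<open>auto simp: isolated_singularity_at_def\<close>)
    have "cmod (h z) \<le> 1"
      by (rule tendsto_upperbound[OF tendsto_norm[OF qc] bd]) auto
    moreover have "h z * g z = f z"
    proof (rule tendsto_unique[of "at z"])
      have "g \<midarrow>z\<rightarrow> g z" "f \<midarrow>z\<rightarrow> f z"
        using holomorphic_on_imp_continuous_on[OF g] holomorphic_on_imp_continuous_on[OF f]
        by (auto simp: continuous_on_eq_continuous_at isCont_def)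
      then show "f \<midarrow>z\<rightarrow> f z" by simp
      have lim: "((\<lambda>w. ?q w * g w) \<longlongrightarrow> h z * g z) (at z)"
        by (rule tendsto_mult[OF qc \<open>g \<midarrow>z\<rightarrow> g z\<close>])
      have "\<forall>\<^sub>F w in at z. ?q w * g w = f w" using ev by eventually_elim auto
      from tendsto_cong[OF this] lim
      show "f \<midarrow>z\<rightarrow> h z * g z" by blast
    qed auto
    ultimately show ?thesis using eq an by simp
  qed
  have inv: "cmod (1 / w) > s" if "w \<in> ball 0 (1 / s) - {0}" for w
    using that s by (auto simp: norm_divide field_simps)
  \<comment> \<open>Infinity becomes the point w = 0; the same bound by 1 makes it removable
    too.\<close>
  let ?\<psi> = "\<lambda>w. \<phi> (1 / w)"
  have "\<phi> analytic_on {z. cmod z > s}"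
    using loc by (subst analytic_on_analytic_at) auto
  then have "\<phi> holomorphic_on {z. cmod z > s}" by (rule analytic_imp_holomorphic)
  then have "(\<phi> \<circ> (\<lambda>w. 1 / w)) holomorphic_on ball 0 (1 / s) - {0}"
    by (intro holomorphic_on_compose_gen[where t = "{z. cmod z > s}"] holomorphic_intros) (use inv in auto)
  then have hol: "?\<psi> holomorphic_on ball 0 (1 / s) - {0}" by (simp add: o_def)
  have "\<forall>\<^sub>F w in at 0. w \<in> ball 0 (1 / s) - {0 :: complex}"
    using s by (intro eventually_at_in_open) auto
  then have "\<forall>\<^sub>F w in at 0. cmod (?\<psi> w) \<le> 1"
    by eventually_elim (use loc inv in blast)
  then have "\<exists>h. h holomorphic_on ball 0 (1 / s) \<and> (\<forall>w\<in>ball 0 (1 / s) - {0}. h w = ?\<psi> w)"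
    using holomorphic_on_extend_bounded[OF hol] s by auto
  then obtain \<psi> where \<psi>: "\<psi> holomorphic_on ball 0 (1 / s)" "\<And>w. w \<in> ball 0 (1 / s) - {0} \<Longrightarrow> \<psi> w = ?\<psi> w"
    by blast
  show ?thesis
    by (rule that[OF \<psi>(1)]) (use loc inv \<psi>(2) in \<open>simp\<close>)
qed

text \<open>On the circle, \<open>?A z + H (cnj z)\<close> equals
  \<open>\<psi> (cnj z) * ?B z\<close>. The first summand has frequencies >= 0 and the second
  negative ones, so dropping the second can only lower the mean square, and |\<psi>| <= 1 does the
  rest. The condition \<open>s < 1\<close> makes \<open>\<psi>\<close> holomorphic on a disc larger
  than the unit disc.\<close>

lemma tail_sum_le:
  assumes a: "entire_coeffs a" and b: "entire_coeffs b" and b0: "\<exists>z. powser b z \<noteq> 0"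
    and s: "0 < s" "s < 1" and le: "\<And>z. cmod z > s \<Longrightarrow> cmod (powser a z) \<le> cmod (powser b z)"
  shows "(\<Sum>n. (cmod (a (n + N)))\<^sup>2) \<le> (\<Sum>n. (cmod (b (n + N)))\<^sup>2)"
proof -
  obtain \<psi> where \<psi>: "\<psi> holomorphic_on ball 0 (1 / s)"
    "\<And>w. w \<in> ball 0 (1 / s) - {0} \<Longrightarrow> cmod (\<psi> w) \<le> 1 \<and> \<psi> w * powser b (1 / w) = powser a (1 / w)"
    using ex_reflected_quotient[OF powser_holomorphic[OF a] powser_holomorphic[OF b] b0 s(1) le] by metis
  have s1: "1 / s > 1" using s by simp
  let ?A = "powser (\<lambda>n. a (n + N))" and ?B = "powser (\<lambda>n. b (n + N))"
  \<comment> \<open>On the unit circle \<open>cnj z = 1 / z\<close>, so \<open>z ^ N * H (cnj z)\<close> is the part of frequencies below \<open>N\<close> of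
    \<open>\<psi> (1 / z) * z ^ N * ?B z\<close>.\<close>
  define H where "H w = (\<Sum>k<N. (a k - b k * \<psi> w) * w ^ (N - k))" for w
  have H: "H holomorphic_on ball 0 (1 / s)"
    unfolding H_def by (intro holomorphic_intros \<psi>(1))
  \<comment> \<open>For k < N the exponents N - k are at least 1, so \<open>H (cnj z)\<close> has
    strictly negative frequencies.\<close>
  have H0: "H 0 = 0"
    by (auto simp: H_def intro!: sum.neutral)
  have cA: "continuous_on (sphere 0 1) ?A" and cB: "continuous_on (sphere 0 1) ?B"
    by (auto intro!: holomorphic_on_imp_continuous_on powser_holomorphic entire_coeffs_shift a b)
  have cH: "continuous_on (sphere 0 1) (\<lambda>z. H (cnj z))"
    by (intro continuous_on_compose2[OF holomorphic_on_imp_continuous_on[OF H]] continuous_intros)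
       (use s1 in auto)
  have key: "cmod (?A z + H (cnj z)) \<le> cmod (?B z)" if z: "cmod z = 1" for z
  proof -
    have zz: "z * cnj z = 1" using z by (simp add: complex_norm_square[symmetric])
    then have z0: "z \<noteq> 0" "cnj z \<noteq> 0" by auto
    have inv: "1 / cnj z = z" using zz z0 by (simp add: field_simps)
    have w: "cnj z \<in> ball 0 (1 / s) - {0}" using z s1 z0 by auto
    have eq: "\<psi> (cnj z) * powser b z = powser a z" and le1: "cmod (\<psi> (cnj z)) \<le> 1"
      using \<psi>(2)[OF w] by (auto simp: inv)
    have pw: "z ^ N * cnj z ^ (N - k) = z ^ k" if "k < N" for k
    proof -
      have "z ^ N = z ^ k * z ^ (N - k)" using that by (simp flip: power_add)
      then show ?thesis using zz by (simp add: mult.assoc flip: power_mult_distrib)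
    qed
    have "z ^ N * H (cnj z) = (\<Sum>k<N. (a k - b k * \<psi> (cnj z)) * z ^ k)"
      unfolding H_def sum_distrib_left by (intro sum.cong) (auto simp: pw[symmetric] mult_ac)
    also have "\<dots> = (\<Sum>k<N. a k * z ^ k) - \<psi> (cnj z) * (\<Sum>k<N. b k * z ^ k)"
      by (simp add: sum_distrib_left sum_subtractf algebra_simps)
    finally have zH: "z ^ N * H (cnj z) = (\<Sum>k<N. a k * z ^ k) - \<psi> (cnj z) * (\<Sum>k<N. b k * z ^ k)" .
    have zA: "z ^ N * ?A z = powser a z - (\<Sum>k<N. a k * z ^ k)"
      and zB: "z ^ N * ?B z = powser b z - (\<Sum>k<N. b k * z ^ k)"
      using powser_split[OF a, of z N] powser_split[OF b, of z N] by simp_all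
    have "z ^ N * (?A z + H (cnj z)) = \<psi> (cnj z) * (z ^ N * ?B z)"
      unfolding distrib_left[of "z ^ N"] zA zH zB eq[symmetric] by (simp add: algebra_simps)
    then have "cmod (z ^ N * (?A z + H (cnj z))) = cmod (\<psi> (cnj z) * (z ^ N * ?B z))"
      by (rule arg_cong)
    then have "cmod (?A z + H (cnj z)) = cmod (\<psi> (cnj z)) * cmod (?B z)"
      using z by (simp add: norm_mult norm_power)
    also have "\<dots> \<le> 1 * cmod (?B z)" using le1 by (intro mult_right_mono) auto
    finally show ?thesis by simp
  qed
  have "(\<Sum>n. (cmod (a (n + N)))\<^sup>2) = circle_mean (\<lambda>z. (cmod (?A z))\<^sup>2)"
    using parseval[OF entire_coeffs_shift[OF a]] by (simp add: sums_iff)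
  also have "\<dots> \<le> circle_mean (\<lambda>z. (cmod (?A z))\<^sup>2) + circle_mean (\<lambda>z. (cmod (H (cnj z)))\<^sup>2)"
  proof -
    have "circle_mean (\<lambda>_. 0) \<le> circle_mean (\<lambda>z. (cmod (H (cnj z)))\<^sup>2)"
      by (intro circle_mean_mono continuous_intros cH) auto
    then show ?thesis by simp
  qed
  also have "\<dots> = circle_mean (\<lambda>z. (cmod (?A z + H (cnj z)))\<^sup>2)"
    by (rule circle_mean_pythagoras[OF powser_holomorphic H s1 H0, symmetric])
       (intro entire_coeffs_shift a)
  also have "\<dots> \<le> circle_mean (\<lambda>z. (cmod (?B z))\<^sup>2)"
    by (intro circle_mean_mono continuous_intros cA cB cH power_mono key) auto
  also have "\<dots> = (\<Sum>n. (cmod (b (n + N)))\<^sup>2)"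
    using parseval[OF entire_coeffs_shift[OF b]] by (simp add: sums_iff)
  finally show ?thesis .
qed

section \<open>The Korenblum radius of a radial weight\<close>

definition moment :: "(real \<Rightarrow> real) \<Rightarrow> nat \<Rightarrow> real" where
  "moment W k = set_lebesgue_integral lebesgue {0..} (\<lambda>t. t ^ k * W t)"

lemma radial_weight_nonneg: "radial_weight W \<Longrightarrow> t \<ge> 0 \<Longrightarrow> W t \<ge> 0"
  by (simp add: radial_weight_def)

lemma radial_weight_set_integrable:
  "radial_weight W \<Longrightarrow> set_integrable lebesgue {0..} (\<lambda>t. t ^ k * W t)"
  by (simp add: radial_weight_def)

lemma moment_nonneg:
  assumes "radial_weight W"
  shows "moment W k \<ge> 0"
  unfolding moment_def set_lebesgue_integral_def
  using assms by (intro integral_nonneg_AE) (auto simp: indicator_def radial_weight_nonneg)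

lemma moment_pos:
  assumes W: "radial_weight W"
  shows "moment W k > 0"
proof (rule ccontr)
  assume "\<not> moment W k > 0"
  then have "moment W k = 0" using moment_nonneg[OF W, of k] by simp
  then have "AE t in lebesgue. indicat_real {0..} t *\<^sub>R (t ^ k * W t) = 0"
    unfolding moment_def set_lebesgue_integral_def
    using radial_weight_set_integrable[OF W, of k] unfolding set_integrable_def
    by (subst (asm) integral_nonneg_eq_0_iff_AE) (auto simp: indicator_def radial_weight_nonneg[OF W])
  moreover have "AE t in lebesgue. t \<noteq> (0::real)"
    by (rule AE_I'[of "{0}"]) auto
  ultimately have "AE t in lebesgue. t \<in> {0..} \<longrightarrow> W t = 0"
    by eventually_elim (auto simp: indicator_def)
  then have "AE t in lebesgue_on {0..}. W t = 0"
    by (subst AE_restrict_space_iff) auto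
  then show False using W by (simp add: radial_weight_def)
qed

lemma moment_log_convex:
  assumes W: "radial_weight W"
  shows "(moment W (Suc k))\<^sup>2 \<le> moment W k * moment W (Suc (Suc k))"
proof -
  let ?I = "\<lambda>f. LINT t:{0..}|lebesgue. f t"
  note int = radial_weight_set_integrable[OF W]
  \<comment> \<open>Cauchy-Schwarz: the minimiser \<open>c\<close> of the integral of \<open>t ^ k * (t - c)\<^sup>2 * W t\<close>.\<close>
  define c where "c = moment W (Suc k) / moment W k"
  have "0 \<le> ?I (\<lambda>t. t ^ k * (t - c)\<^sup>2 * W t)"
    unfolding set_lebesgue_integral_def
    using W by (intro integral_nonneg_AE) (auto simp: indicator_def radial_weight_nonneg)
  also have "(\<lambda>t. t ^ k * (t - c)\<^sup>2 * W t) =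
      (\<lambda>t. (t ^ Suc (Suc k) * W t + c\<^sup>2 * (t ^ k * W t)) - 2 * c * (t ^ Suc k * W t))"
    by (auto simp: power2_eq_square algebra_simps)
  also have "?I \<dots> = moment W (Suc (Suc k)) + c\<^sup>2 * moment W k - 2 * c * moment W (Suc k)"
    unfolding moment_def using int by (simp add: set_integral_diff set_integral_add del: power_Suc)
  finally have "0 \<le> moment W k * (moment W (Suc (Suc k)) + c\<^sup>2 * moment W k - 2 * c * moment W (Suc k))"
    using moment_nonneg[OF W] by simp
  also have "\<dots> = moment W k * moment W (Suc (Suc k)) - (moment W (Suc k))\<^sup>2"
    using moment_pos[OF W, of k] by (simp add: c_def power2_eq_square field_simps)
  finally show ?thesis by simp
qed

text \<open>By log-convexity the quotients of consecutive moments increase, so the first one is the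
  smallest.\<close>

lemma moment_ratio_mono:
  assumes W: "radial_weight W"
  shows "moment W 1 / moment W 0 * moment W k \<le> moment W (Suc k)"
proof (induction k)
  case (Suc k)
  note pos = moment_pos[OF W]
  have "moment W 1 / moment W 0 \<le> moment W (Suc k) / moment W k"
    using Suc pos[of k] by (simp add: field_simps)
  also have "\<dots> \<le> moment W (Suc (Suc k)) / moment W (Suc k)"
    using moment_log_convex[OF W, of k] pos[of k] pos[of "Suc k"] by (simp add: field_simps power2_eq_square)
  finally show ?case using pos[of "Suc k"] by (simp add: field_simps)
qed (use moment_pos[OF W, of 0] in simp)

section \<open>Membership and norm in the Fock space in terms of Taylor coefficients and
  moments\<close>

lemma radial_weight_borel_version:
  assumes W: "radial_weight W"
  obtains V where "V \<in> borel_measurable borel" "AE t in lborel. t \<ge> 0 \<longrightarrow> W t = V t"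
    "AE z::complex in lborel. W ((cmod z)\<^sup>2) = V ((cmod z)\<^sup>2)"
proof -
  \<comment> \<open>A Lebesgue measurable weight is replaced by a Borel one, whose composition with
    the squared modulus is clearly measurable.\<close>
  have "(\<lambda>t. indicator {0..} t *\<^sub>R W t) \<in> borel_measurable lebesgue"
    using W unfolding radial_weight_def by (subst (asm) borel_measurable_restrict_space_iff) auto
  then obtain V where V: "V \<in> borel_measurable lborel" "AE t in lborel. indicator {0..} t *\<^sub>R W t = V t"
    using completion_ex_borel_measurable_real by blast
  have 1: "AE t in lborel. t \<ge> 0 \<longrightarrow> W t = V t"
    using V(2) by eventually_elim (auto simp: indicator_def)
  have "AE z::complex in lborel. W ((cmod z)\<^sup>2) = V ((cmod z)\<^sup>2)"
    using AE_cmod_square[OF 1] by simp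
  with V(1) 1 show ?thesis using that by simp
qed

lemma fock_integrand_measurable:
  assumes W: "radial_weight W" and f: "f holomorphic_on UNIV"
  shows "(\<lambda>z. (cmod (f z))\<^sup>2 * W ((cmod z)\<^sup>2)) \<in> borel_measurable lebesgue"
proof -
  obtain V where V[measurable]: "V \<in> borel_measurable borel"
    and ae0: "AE t in lborel. t \<ge> 0 \<longrightarrow> W t = V t"
    and ae: "AE z::complex in lborel. W ((cmod z)\<^sup>2) = V ((cmod z)\<^sup>2)"
    by (rule radial_weight_borel_version[OF W])
  have [measurable]: "f \<in> borel_measurable borel"
    by (intro borel_measurable_continuous_onI holomorphic_on_imp_continuous_on f)
  have "(\<lambda>z. (cmod (f z))\<^sup>2 * V ((cmod z)\<^sup>2)) \<in> borel_measurable lebesgue"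
    by (intro measurable_completion) measurable
  moreover have "AE z in lebesgue. (cmod (f z))\<^sup>2 * V ((cmod z)\<^sup>2) = (cmod (f z))\<^sup>2 * W ((cmod z)\<^sup>2)"
    using AE_completion[OF ae] by eventually_elim simp
  ultimately show ?thesis by (rule borel_measurable_AE)
qed

text \<open>As an identity in [0, \<infinity>] it serves both to decide membership and to compute
  the norm. The factor \<open>pi\<close> is cancelled by the 1 / pi in
  \<open>fock_norm\<close>.\<close>

lemma nn_integral_fock:
  assumes W: "radial_weight W" and a: "entire_coeffs a"
  shows "(\<integral>\<^sup>+z. ennreal ((cmod (powser a z))\<^sup>2 * W ((cmod z)\<^sup>2)) \<partial>lebesgue) =
    ennreal pi * (\<Sum>n. ennreal ((cmod (a n))\<^sup>2 * moment W n))"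
proof -
  obtain V where V[measurable]: "V \<in> borel_measurable borel"
    and ae0: "AE t in lborel. t \<ge> 0 \<longrightarrow> W t = V t"
    and ae: "AE z::complex in lborel. W ((cmod z)\<^sup>2) = V ((cmod z)\<^sup>2)"
    by (rule radial_weight_borel_version[OF W])
  have mom: "(\<integral>\<^sup>+t. indicator {0..} t * (ennreal (t ^ n) * ennreal (V t)) \<partial>lborel) = ennreal (moment W n)" for n
  proof -
    have "(\<integral>\<^sup>+t. indicator {0..} t * (ennreal (t ^ n) * ennreal (V t)) \<partial>lborel)
        = (\<integral>\<^sup>+t. ennreal (indicator {0..} t *\<^sub>R (t ^ n * W t)) \<partial>lborel)"
      using ae0 by (intro nn_integral_cong_AE, eventually_elim) (auto simp: indicator_def ennreal_mult')
    also have "\<dots> = (\<integral>\<^sup>+t. ennreal (indicator {0..} t *\<^sub>R (t ^ n * W t)) \<partial>lebesgue)"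
      by (simp add: nn_integral_completion)
    also have "\<dots> = ennreal (moment W n)"
      unfolding moment_def set_lebesgue_integral_def
      using radial_weight_set_integrable[OF W, of n] unfolding set_integrable_def
      by (intro nn_integral_eq_integral) (auto simp: indicator_def radial_weight_nonneg[OF W])
    finally show ?thesis .
  qed
  have "(\<integral>\<^sup>+z. ennreal ((cmod (powser a z))\<^sup>2 * W ((cmod z)\<^sup>2)) \<partial>lebesgue)
      = (\<integral>\<^sup>+z. ennreal ((cmod (powser a z))\<^sup>2) * ennreal (V ((cmod z)\<^sup>2)) \<partial>lborel)"
    unfolding nn_integral_completion
    using ae by (intro nn_integral_cong_AE, eventually_elim) (simp add: ennreal_mult')
  also have "\<dots> = ennreal pi * (\<Sum>n. ennreal ((cmod (a n))\<^sup>2 * moment W n))"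
    using nn_integral_powser_radial[OF a, of "\<lambda>t. ennreal (V t)"]
    by (simp add: mom ennreal_mult' moment_nonneg[OF W])
  finally show ?thesis .
qed

lemma powser_in_fock_space_iff:
  assumes W: "radial_weight W" and a: "entire_coeffs a"
  shows "powser a \<in> fock_space W \<longleftrightarrow> summable (\<lambda>n. (cmod (a n))\<^sup>2 * moment W n)"
proof -
  let ?h = "\<lambda>z. (cmod (powser a z))\<^sup>2 * W ((cmod z)\<^sup>2)"
  have nn: "?h z \<ge> 0" for z using radial_weight_nonneg[OF W] by simp
  have t: "(cmod (a n))\<^sup>2 * moment W n \<ge> 0" for n using moment_nonneg[OF W] by simp
  have "powser a \<in> fock_space W \<longleftrightarrow> integrable lebesgue ?h"
    by (simp add: fock_space_def powser_holomorphic[OF a])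
  also have "\<dots> \<longleftrightarrow> (\<integral>\<^sup>+z. ennreal (?h z) \<partial>lebesgue) < \<infinity>"
    unfolding integrable_iff_bounded
    using fock_integrand_measurable[OF W powser_holomorphic[OF a]] nn by simp
  also have "\<dots> \<longleftrightarrow> (\<Sum>n. ennreal ((cmod (a n))\<^sup>2 * moment W n)) < \<infinity>"
    by (auto simp: nn_integral_fock[OF W a] ennreal_mult_less_top)
  also have "\<dots> \<longleftrightarrow> summable (\<lambda>n. (cmod (a n))\<^sup>2 * moment W n)"
  proof
    assume "(\<Sum>n. ennreal ((cmod (a n))\<^sup>2 * moment W n)) < \<infinity>"
    then show "summable (\<lambda>n. (cmod (a n))\<^sup>2 * moment W n)"
      using t by (intro summable_suminf_not_top) auto
  next
    assume s: "summable (\<lambda>n. (cmod (a n))\<^sup>2 * moment W n)"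
    show "(\<Sum>n. ennreal ((cmod (a n))\<^sup>2 * moment W n)) < \<infinity>"
      by (subst suminf_ennreal2[OF t s]) simp
  qed
  finally show ?thesis .
qed

lemma fock_norm_powser:
  assumes W: "radial_weight W" and a: "entire_coeffs a" 
    and sm: "summable (\<lambda>n. (cmod (a n))\<^sup>2 * moment W n)"
  shows "fock_norm W (powser a) = sqrt (\<Sum>n. (cmod (a n))\<^sup>2 * moment W n)"
proof -
  have t: "(cmod (a n))\<^sup>2 * moment W n \<ge> 0" for n using moment_nonneg[OF W] by simp
  have "(\<integral>z. (cmod (powser a z))\<^sup>2 * W ((cmod z)\<^sup>2) \<partial>lebesgue)
     = enn2real (ennreal pi * (\<Sum>n. ennreal ((cmod (a n))\<^sup>2 * moment W n)))"
    using fock_integrand_measurable[OF W powser_holomorphic[OF a]]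
    by (subst integral_eq_nn_integral) (auto simp: nn_integral_fock[OF W a] radial_weight_nonneg[OF W])
  also have "\<dots> = pi * (\<Sum>n. (cmod (a n))\<^sup>2 * moment W n)"
    by (subst suminf_ennreal2[OF t sm]) (simp add: enn2real_mult suminf_nonneg[OF sm t])
  finally show ?thesis by (simp add: fock_norm_def)
qed

lemma entire_eq_powser:
  assumes "f holomorphic_on UNIV"
  obtains a where "entire_coeffs a" "f = powser a"
proof -
  define a where "a n = (deriv ^^ n) f 0 / fact n" for n
  have s: "(\<lambda>n. a n * z ^ n) sums f z" for z
    using holomorphic_power_series[of f 0 "cmod z + 1" z] holomorphic_on_subset[OF assms]
    by (simp add: a_def)
  then have "entire_coeffs a" "f = powser a"
    by (auto simp: entire_coeffs_def powser_def sums_iff)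
  with that show ?thesis by blast
qed

lemma powser_single:
  "entire_coeffs (\<lambda>n. if n = k then c else 0)" "powser (\<lambda>n. if n = k then c else 0) = (\<lambda>z. c * z ^ k)"
proof -
  have "(\<lambda>n. (if n = k then c else 0) * z ^ n) sums (c * z ^ k)" for z
    using sums_single[of k "\<lambda>n. c * z ^ n"] by (simp add: if_distrib[of "\<lambda>x. x * _"] cong: if_cong)
  then show "entire_coeffs (\<lambda>n. if n = k then c else 0)" "powser (\<lambda>n. if n = k then c else 0) = (\<lambda>z. c * z ^ k)"
    by (auto simp: entire_coeffs_def powser_def sums_iff)
qed

lemma fock_monomial:
  assumes W: "radial_weight W"
  shows "(\<lambda>z. c * z ^ k) \<in> fock_space W" "fock_norm W (\<lambda>z. c * z ^ k) = sqrt ((cmod c)\<^sup>2 * moment W k)"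
proof -
  let ?a = "\<lambda>n. if n = k then c else 0"
  have "(\<lambda>n. (cmod (?a n))\<^sup>2 * moment W n) sums ((cmod c)\<^sup>2 * moment W k)"
    using sums_single[of k "\<lambda>n. (cmod c)\<^sup>2 * moment W n"]
    by (rule sums_cong[THEN iffD1, rotated]) auto
  then have "summable (\<lambda>n. (cmod (?a n))\<^sup>2 * moment W n)" "(\<Sum>n. (cmod (?a n))\<^sup>2 * moment W n) = (cmod c)\<^sup>2 * moment W k"
    by (simp_all add: sums_iff)
  then show "(\<lambda>z. c * z ^ k) \<in> fock_space W" "fock_norm W (\<lambda>z. c * z ^ k) = sqrt ((cmod c)\<^sup>2 * moment W k)"
    using powser_in_fock_space_iff[OF W powser_single(1), of k c] fock_norm_powser[OF W powser_single(1), of k c]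
    unfolding powser_single(2) by simp_all
qed

section \<open>Upper bound for admissible radii, and admissibility of the extremal radius\<close>

lemma admissible_radius_le:
  assumes W: "radial_weight W" and R: "admissible_radius W R"
  shows "R \<le> sqrt (moment W 1 / moment W 0)"
proof -
  have "R > 0" using R by (simp add: admissible_radius_def)
  have "fock_norm W (\<lambda>z. of_real R * z ^ 0) \<le> fock_norm W (\<lambda>z. 1 * z ^ 1)"
    using R fock_monomial(1)[OF W, of "of_real R" 0] fock_monomial(1)[OF W, of 1 1]
    unfolding admissible_radius_def by (auto dest!: bspec)
  then have "R\<^sup>2 * moment W 0 \<le> moment W 1"
    unfolding fock_monomial(2)[OF W] by simp
  then have "R\<^sup>2 \<le> moment W 1 / moment W 0"
    using moment_pos[OF W, of 0] by (simp add: field_simps)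
  then show ?thesis by (rule real_le_rsqrt)
qed

text \<open>A nondecreasing nonnegative weight is \<open>c 0\<close> plus nonnegative increments,
  each multiplying a full tail; tail inequalities therefore add up to the weighted
  inequality.\<close>

lemma abel_sum_le:
  fixes A B c :: "nat \<Rightarrow> real"
  assumes A: "summable A" "\<And>n. A n \<ge> 0" and B: "summable B" "\<And>n. B n \<ge> 0"
    and tail: "\<And>N. (\<Sum>n. A (n + N)) \<le> (\<Sum>n. B (n + N))"
    and c: "c 0 \<ge> 0" "incseq c"
    and cA: "summable (\<lambda>n. c n * A n)" and cB: "summable (\<lambda>n. c n * B n)"
  shows "(\<Sum>n. c n * A n) \<le> (\<Sum>n. c n * B n)"
proof -
  have sA: "summable (\<lambda>n. A (n + N))" and sB: "summable (\<lambda>n. B (n + N))"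
    and scB: "summable (\<lambda>n. c (n + N) * B (n + N))" for N
    by (rule summable_ignore_initial_segment[OF A(1)] summable_ignore_initial_segment[OF B(1)]
        summable_ignore_initial_segment[OF cB])+
  define TA where "TA N = (\<Sum>n. A (n + N))" for N
  define TB where "TB N = (\<Sum>n. B (n + N))" for N
  have TAs: "TA N = A N + TA (Suc N)" for N
    unfolding TA_def using suminf_split_head[OF sA[of N]] by simp
  have TBs: "TB N = B N + TB (Suc N)" for N
    unfolding TB_def using suminf_split_head[OF sB[of N]] by simp
  have cn: "c n \<ge> 0" for n using c incseqD[OF c(2), of 0 n] by simp
  \<comment> \<open>Both sides are the series with the weight frozen at \<open>c M\<close> from
    index M on. Passing from M to M + 1 adds the increment of \<open>c\<close> times a tail.\<close>
  have key: "(\<Sum>n<Suc M. c n * A n) + c M * TA (Suc M) \<le> (\<Sum>n<Suc M. c n * B n) + c M * TB (Suc M)" for M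
  proof (induction M)
    case 0
    have "c 0 * TA 0 \<le> c 0 * TB 0" 
      using tail[of 0] c(1) unfolding TA_def TB_def by (rule mult_left_mono)
    then show ?case using TAs[of 0] TBs[of 0] by (simp add: algebra_simps)
  next
    case (Suc M)
    have "(c (Suc M) - c M) * TA (Suc M) \<le> (c (Suc M) - c M) * TB (Suc M)"
      using tail[of "Suc M"] incseqD[OF c(2), of M "Suc M"] unfolding TA_def TB_def
      by (intro mult_left_mono) auto
    then show ?case using Suc TAs[of "Suc M"] TBs[of "Suc M"] by (simp add: algebra_simps)
  qed
  have TA0: "TA N \<ge> 0" for N
    unfolding TA_def by (rule suminf_nonneg[OF sA]) (rule A(2))
  have partial: "(\<Sum>n<Suc M. c n * A n) \<le> (\<Sum>n. c n * B n)" for M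
  proof -
    have "c M * TB (Suc M) = (\<Sum>n. c M * B (n + Suc M))"
      unfolding TB_def by (rule suminf_mult[OF sB, symmetric])
    also have "\<dots> \<le> (\<Sum>n. c (n + Suc M) * B (n + Suc M))"
      using B(2) incseqD[OF c(2)]
      by (intro suminf_le summable_mult sB scB mult_right_mono) auto
    finally have "(\<Sum>n<Suc M. c n * B n) + c M * TB (Suc M) \<le> (\<Sum>n. c n * B n)"
      using suminf_split_initial_segment[OF cB, of "Suc M"] by simp
    moreover have "0 \<le> c M * TA (Suc M)" using cn TA0 by simp
    ultimately show ?thesis using key[of M] by linarith
  qed
  have "(\<Sum>n<M. c n * A n) \<le> (\<Sum>n. c n * B n)" for M
    using mult_nonneg_nonneg[OF cn A(2), of M M] by (intro order_trans[OF _ partial[of M]]) simp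
  then show ?thesis using cA by (intro suminf_le_const) auto
qed

text \<open>For x >= 0 this is Parseval on the circle of radius \<open>sqrt x\<close>; for other x
  absolute convergence at |x| suffices.\<close>

lemma powser_square_summable:
  assumes a: "entire_coeffs a"
  shows "summable (\<lambda>n. (cmod (a n))\<^sup>2 * x ^ n)"
proof -
  have "summable (\<lambda>n. (cmod (a n * of_real (sqrt \<bar>x\<bar>) ^ n))\<^sup>2)"
    using parseval[OF entire_coeffs_scale[OF a]] by (rule sums_summable)
  moreover have "(sqrt \<bar>x\<bar> ^ n)\<^sup>2 = \<bar>x\<bar> ^ n" for n
    by (simp add: power2_eq_square flip: power_mult_distrib)
  then have "(\<lambda>n. (cmod (a n * of_real (sqrt \<bar>x\<bar>) ^ n))\<^sup>2) = (\<lambda>n. norm ((cmod (a n))\<^sup>2 * x ^ n))"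
    by (simp add: norm_mult norm_power power_mult_distrib abs_mult power_abs)
  ultimately show ?thesis by (intro summable_norm_cancel[where f = "\<lambda>n. (cmod (a n))\<^sup>2 * x ^ n"]) simp
qed

text \<open>For r > R, rescaling z by r turns R into s = R / r < 1, as the comparison on the unit
  circle demands. The value r = R is reached only in the limit.\<close>

lemma tail_sum_le_boundary:
  assumes a: "entire_coeffs a" and b: "entire_coeffs b" and b0: "\<exists>z. powser b z \<noteq> 0"
    and R: "R > 0" and le: "\<And>z. cmod z > R \<Longrightarrow> cmod (powser a z) \<le> cmod (powser b z)"
  shows "(\<Sum>n. (cmod (a (n + N)))\<^sup>2 * (R\<^sup>2) ^ (n + N)) \<le> (\<Sum>n. (cmod (b (n + N)))\<^sup>2 * (R\<^sup>2) ^ (n + N))"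
proof -
  \<comment> \<open>With the factor x^N removed, the tail is a power series in x = r^2 converging
    everywhere, hence continuous at R^2.\<close>
  define S where "S a x = (\<Sum>n. (cmod (a (n + N)))\<^sup>2 * x ^ n)" for a :: "nat \<Rightarrow> complex" and x :: real
  have shift: "(\<Sum>n. (cmod (a (n + N)))\<^sup>2 * x ^ (n + N)) = x ^ N * S a x" if "entire_coeffs a" for a x
    unfolding S_def using powser_square_summable[OF entire_coeffs_shift[OF that, of N], of x]
    by (subst suminf_mult[symmetric]) (auto simp: power_add mult_ac)
  have cont: "isCont (S a) x" if "entire_coeffs a" for a x
    unfolding S_def by (intro isCont_powser_converges_everywhere powser_square_summable entire_coeffs_shift that)
  have "S a x \<le> S b x" if x: "x > R\<^sup>2" for x
  proof -
    define r where "r = sqrt x"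
    have x0: "x > 0" using x R by (meson less_trans zero_less_power)
    have r: "r > R" "r > 0" "r\<^sup>2 = x"
      using x x0 R by (auto simp: r_def real_less_rsqrt)
    have sq: "(cmod (a n * of_real r ^ n))\<^sup>2 = (cmod (a n))\<^sup>2 * x ^ n" for a :: "nat \<Rightarrow> complex" and n
      using r by (simp add: norm_mult norm_power power_mult_distrib power2_eq_square flip: r(3))
    have "(\<Sum>n. (cmod (a (n + N) * of_real r ^ (n + N)))\<^sup>2) \<le> (\<Sum>n. (cmod (b (n + N) * of_real r ^ (n + N)))\<^sup>2)"
    proof (rule tail_sum_le[where s = "R / r"])
      show "\<exists>z. powser (\<lambda>n. b n * of_real r ^ n) z \<noteq> 0"
      proof -
        obtain z where "powser b z \<noteq> 0" using b0 by auto
        then show ?thesis using r by (intro exI[of _ "z / of_real r"]) (simp add: powser_scale)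
      qed
      fix z :: complex assume "cmod z > R / r"
      then have "cmod (z * of_real r) > R" using r by (simp add: norm_mult field_simps)
      from le[OF this] show "cmod (powser (\<lambda>n. a n * of_real r ^ n) z) \<le> cmod (powser (\<lambda>n. b n * of_real r ^ n) z)"
        by (simp add: powser_scale)
    qed (use r R a b in \<open>auto intro: entire_coeffs_scale\<close>)
    then have "x ^ N * S a x \<le> x ^ N * S b x"
      unfolding sq by (simp add: shift a b)
    then show ?thesis using x0 by simp
  qed
  then have ev: "\<forall>\<^sub>F x in at_right (R\<^sup>2). S a x \<le> S b x"
    by (auto simp: eventually_at_filter)
  have "S a (R\<^sup>2) \<le> S b (R\<^sup>2)"
  proof (rule tendsto_le[OF _ _ _ ev])
    show "(S a \<longlongrightarrow> S a (R\<^sup>2)) (at_right (R\<^sup>2))" "(S b \<longlongrightarrow> S b (R\<^sup>2)) (at_right (R\<^sup>2))"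
      using cont[OF a] cont[OF b] by (auto simp: isCont_def intro: tendsto_mono[OF at_le])
  qed simp
  then show ?thesis using R by (simp add: shift a b)
qed

theorem admissible_radius_of_moment_ratio:
  assumes W: "radial_weight W" and R: "R > 0" and mom: "\<And>k. R\<^sup>2 * moment W k \<le> moment W (Suc k)"
  shows "admissible_radius W R"
  unfolding admissible_radius_def
proof (intro conjI ballI impI R)
  fix f g assume f: "f \<in> fock_space W" and g: "g \<in> fock_space W"
    and le: "\<forall>z. cmod z > R \<longrightarrow> cmod (f z) \<le> cmod (g z)"
  obtain a where a: "entire_coeffs a" "f = powser a"
    using f entire_eq_powser unfolding fock_space_def by blast
  obtain b where b: "entire_coeffs b" "g = powser b"
    using g entire_eq_powser unfolding fock_space_def by blast
  have sa: "summable (\<lambda>n. (cmod (a n))\<^sup>2 * moment W n)" 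
    using f unfolding a(2) powser_in_fock_space_iff[OF W a(1)] .
  have sb: "summable (\<lambda>n. (cmod (b n))\<^sup>2 * moment W n)" 
    using g unfolding b(2) powser_in_fock_space_iff[OF W b(1)] .
  show "fock_norm W f \<le> fock_norm W g"
  proof (cases "\<exists>z. g z \<noteq> 0")
    case False
    \<comment> \<open>Without a nonzero \<open>g\<close> there is no quotient; here \<open>f\<close>
      vanishes outside a disc, hence everywhere by the identity theorem.\<close>
    then have g0: "g z = 0" for z by auto
    have "f z = 0" for z
    proof (rule analytic_continuation_open[of "{z. R < cmod z}" UNIV f "\<lambda>_. 0"])
      show "open {z::complex. R < cmod z}" by (intro open_Collect_less continuous_intros)
      show "{z::complex. R < cmod z} \<noteq> {}"
        by (auto intro!: exI[of _ "of_real (\<bar>R\<bar> + 1)"])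
    qed (use f le g0 in \<open>auto simp: fock_space_def\<close>)
    then have "f = g" using g0 by auto
    then show ?thesis by simp
  next
    case True
    \<comment> \<open>Splitting the moment into \<open>c n\<close> and R^(2n) leaves exactly the
      terms of the tail inequalities; hypothesis \<open>mom\<close> says that \<open>c\<close> is
      nondecreasing.\<close>
    define c where "c n = moment W n / (R\<^sup>2) ^ n" for n
    have eq: "(cmod (a n))\<^sup>2 * moment W n = c n * ((cmod (a n))\<^sup>2 * (R\<^sup>2) ^ n)" for a :: "nat \<Rightarrow> complex" and n
      using R by (simp add: c_def)
    have "incseq c"
    proof (rule incseq_SucI)
      fix n show "c n \<le> c (Suc n)"
        using mom[of n] R by (simp add: c_def field_simps)
    qed
    have "(\<Sum>n. (cmod (a n))\<^sup>2 * moment W n) \<le> (\<Sum>n. (cmod (b n))\<^sup>2 * moment W n)"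
      unfolding eq
    proof (rule abel_sum_le)
      show "incseq c" by fact
      show "0 \<le> c 0" using moment_nonneg[OF W] by (simp add: c_def)
      show "summable (\<lambda>n. c n * ((cmod (a n))\<^sup>2 * (R\<^sup>2) ^ n))"
        "summable (\<lambda>n. c n * ((cmod (b n))\<^sup>2 * (R\<^sup>2) ^ n))"
        using sa sb unfolding eq .
      show "(\<Sum>n. (cmod (a (n + N)))\<^sup>2 * (R\<^sup>2) ^ (n + N)) \<le> (\<Sum>n. (cmod (b (n + N)))\<^sup>2 * (R\<^sup>2) ^ (n + N))" for N
        using True le a b by (intro tail_sum_le_boundary R) auto
    qed (auto intro: powser_square_summable a(1) b(1))
    then show ?thesis
      unfolding a(2) b(2) fock_norm_powser[OF W a(1) sa] fock_norm_powser[OF W b(1) sb] by simp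
  qed
qed

text \<open>The upper bound from the test pair itself satisfies the moment criterion, so the
  supremum is a maximum.\<close>

theorem korenblum_radius_eq:
  assumes W: "radial_weight W"
  shows "korenblum_radius W = ennreal (sqrt (moment W 1 / moment W 0))"
    and "admissible_radius W (sqrt (moment W 1 / moment W 0))"
proof -
  let ?R = "sqrt (moment W 1 / moment W 0)"
  have R: "?R > 0" using moment_pos[OF W] by simp
  show adm: "admissible_radius W ?R"
    using moment_ratio_mono[OF W] moment_pos[OF W, of 0] moment_pos[OF W, of 1] R
    by (intro admissible_radius_of_moment_ratio[OF W R]) (simp add: less_imp_le)
  show "korenblum_radius W = ennreal ?R"
    unfolding korenblum_radius_def
  proof (rule antisym)
    show "(SUP R\<in>{R. admissible_radius W R}. ennreal R) \<le> ennreal ?R"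
      by (intro SUP_least ennreal_leI) (use admissible_radius_le[OF W] in auto)
    show "ennreal ?R \<le> (SUP R\<in>{R. admissible_radius W R}. ennreal R)"
      by (rule SUP_upper) (use adm in auto)
  qed
qed

section \<open>Sums of exponentials\<close>

text \<open>The substitution u = \<beta> t^p turns the Gamma integral at (k + 1) / p into this
  one.\<close>

lemma nn_integral_power_times_exp:
  fixes p \<beta> :: real
  assumes p: "p > 0" and \<beta>: "\<beta> > 0"
  shows "(\<integral>\<^sup>+t. indicator {0..} t * ennreal (t ^ k * exp (- \<beta> * t powr p)) \<partial>lborel) =
    ennreal (Gamma ((real k + 1) / p) / p * \<beta> powr (- (real k + 1) / p))"
proof -
  define x where "x = (real k + 1) / p"
  have x: "x > 0" using p by (simp add: x_def)
  define F where "F u = u powr (x - 1) / exp u" for u :: real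
  define g where "g t = \<beta> * t powr p" for t :: real
  define g' where "g' t = \<beta> * (p * t powr (p - 1))" for t :: real
  have "(F has_integral Gamma x) {0..}"
    unfolding F_def by (rule Gamma_integral_real[OF x])
  \<comment> \<open>The point 0 is removed because the substitution is differentiated only on the
    open half-line; it is put back at the end.\<close>
  then have F: "(F has_integral Gamma x) {0<..}"
    by (rule has_integral_spike_set_eq[THEN iffD1, rotated -1])
       (auto intro: negligible_subset[of "{0}"])
  have Fabs: "F absolutely_integrable_on {0<..}"
    using F by (intro nonnegative_absolutely_integrable_1) (auto simp: F_def)
  have img: "g ` {0<..} = {0<..}"
  proof (intro equalityI subsetI)
    fix u :: real assume u: "u \<in> {0<..}"
    have "u = g ((u / \<beta>) powr (1 / p))"
      using u \<beta> p by (simp add: g_def powr_powr)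
    then show "u \<in> g ` {0<..}" using u \<beta> by (intro image_eqI[of _ _ "(u / \<beta>) powr (1 / p)"]) auto
  qed (use \<beta> in \<open>auto simp: g_def\<close>)
  have inj: "inj_on g {0<..}"
  proof (rule inj_onI)
    fix x y assume xy: "x \<in> {0<..}" "y \<in> {0<..}" "g x = g y"
    then have "(x powr p) powr (1 / p) = (y powr p) powr (1 / p)" using \<beta> by (simp add: g_def)
    then show "x = y" using xy p by (simp add: powr_powr)
  qed
  have der: "(g has_field_derivative g' t) (at t within {0<..})" if "t \<in> {0<..}" for t
    unfolding g_def g'_def using that by (auto intro!: derivative_eq_intros)
  have eq: "\<bar>g' t\<bar> * F (g t) = p * \<beta> powr x * (t ^ k * exp (- \<beta> * t powr p))" if t: "t \<in> {0<..}" for t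
  proof -
    have "\<bar>g' t\<bar> * F (g t) = p * (\<beta> powr 1 * \<beta> powr (x - 1)) * (t powr (p - 1) * t powr (p * (x - 1))) * exp (- \<beta> * t powr p)"
      using t \<beta> p by (simp add: g'_def g_def F_def powr_mult powr_powr exp_minus field_simps)
    also have "\<beta> powr 1 * \<beta> powr (x - 1) = \<beta> powr x"
      by (simp only: powr_add[symmetric]) simp
    also have "t powr (p - 1) * t powr (p * (x - 1)) = t ^ k"
    proof -
      have "p - 1 + p * (x - 1) = real k" using p by (simp add: x_def field_simps)
      then show ?thesis using t by (simp add: powr_realpow flip: powr_add)
    qed
    finally show ?thesis by (simp add: mult_ac)
  qed
  have "(\<lambda>t. \<bar>g' t\<bar> * F (g t)) absolutely_integrable_on {0<..} \<and> integral {0<..} (\<lambda>t. \<bar>g' t\<bar> * F (g t)) = Gamma x"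
    using Fabs integral_unique[OF F]
    by (subst has_absolute_integral_change_of_variables_1'[OF _ der inj]) (auto simp: img)
  then have "((\<lambda>t. \<bar>g' t\<bar> * F (g t)) has_integral Gamma x) {0<..}"
    using set_lebesgue_integral_eq_integral(1) by (auto simp: has_integral_iff)
  then have "((\<lambda>t. p * \<beta> powr x * (t ^ k * exp (- \<beta> * t powr p))) has_integral Gamma x) {0<..}"
    by (rule has_integral_eq[rotated]) (rule eq)
  from has_integral_mult_right[OF this, of "1 / (p * \<beta> powr x)"]
  have "((\<lambda>t. t ^ k * exp (- \<beta> * t powr p)) has_integral Gamma x / (p * \<beta> powr x)) {0<..}"
    using p \<beta> by (simp add: field_simps)
  then have "((\<lambda>t. t ^ k * exp (- \<beta> * t powr p)) has_integral Gamma x / (p * \<beta> powr x)) {0..}"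
    by (rule has_integral_spike_set_eq[THEN iffD1, rotated -1])
       (auto intro: negligible_subset[of "{0}"])
  from nn_integral_has_integral_lebesgue[OF _ this]
  have "(\<integral>\<^sup>+t. ennreal (indicator {0..} t * (t ^ k * exp (- \<beta> * t powr p))) \<partial>lborel) = ennreal (Gamma x / (p * \<beta> powr x))"
    by simp
  moreover have "(\<integral>\<^sup>+t. ennreal (indicator {0..} t * (t ^ k * exp (- \<beta> * t powr p))) \<partial>lborel)
     = (\<integral>\<^sup>+t. indicator {0..} t * ennreal (t ^ k * exp (- \<beta> * t powr p)) \<partial>lborel)"
    by (intro nn_integral_cong) (simp split: split_indicator)
  moreover have "Gamma x / (p * \<beta> powr x) = Gamma ((real k + 1) / p) / p * \<beta> powr (- (real k + 1) / p)"
  proof -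
    have "- (real k + 1) / p = - x" unfolding x_def by (rule minus_divide_left[symmetric])
    then show ?thesis by (simp only: powr_minus x_def[symmetric]) (simp add: field_simps)
  qed
  ultimately show ?thesis by simp
qed

text \<open>The maximum of x^q exp (-x) is q^q exp (-q), at x = q; the factor exp (-q) is given
  away.\<close>

lemma exp_minus_le_powr:
  fixes x q :: real
  assumes "x > 0" "q > 0"
  shows "exp (- x) \<le> q powr q * x powr - q"
proof -
  have "q * ln (x / q) \<le> q * (x / q - 1)"
    using assms by (intro mult_left_mono ln_le_minus_one) auto
  then have "- x \<le> q * ln q + - q * ln x"
    using assms by (simp add: ln_div algebra_simps)
  then have "exp (- x) \<le> exp (q * ln q + - q * ln x)" by simp
  also have "\<dots> = q powr q * x powr - q"
    using assms by (simp add: powr_def flip: exp_add)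
  finally show ?thesis .
qed

text \<open>Trading exp (-y) for a multiple of y^(-1/p) turns the summability hypothesis on the
  coefficients into convergence at each t > 0. At t = 0 the series may diverge.\<close>

lemma exp_sum_summable:
  fixes c lam :: "nat \<Rightarrow> real" and \<alpha> p t :: real
  assumes \<alpha>: "\<alpha> > 0" and p: "p > 0" and lam: "\<And>n. lam n > 0" and c: "\<And>n. c n \<ge> 0"
    and sm: "summable (\<lambda>n. c n * lam n powr (- 1 / p))" and t: "t > 0"
  shows "summable (\<lambda>n. c n * exp (- \<alpha> * lam n * t powr p))"
proof (rule summable_comparison_test)
  define q where "q = 1 / p"
  have q: "q > 0" using p by (simp add: q_def)
  define C where "C = q powr q * (\<alpha> * t powr p) powr - q"
  show "\<exists>N. \<forall>n\<ge>N. norm (c n * exp (- \<alpha> * lam n * t powr p)) \<le> C * (c n * lam n powr (- 1 / p))"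
  proof (intro exI allI impI)
    fix n
    have "exp (- (\<alpha> * t powr p * lam n)) \<le> q powr q * (\<alpha> * t powr p * lam n) powr - q"
      using \<alpha> t lam[of n] q by (intro exp_minus_le_powr) auto
    also have "\<dots> = C * lam n powr (- 1 / p)"
      using \<alpha> t lam[of n] by (simp add: C_def powr_mult q_def)
    finally have "c n * exp (- (\<alpha> * t powr p * lam n)) \<le> c n * (C * lam n powr (- 1 / p))"
      using c[of n] by (rule mult_left_mono)
    then show "norm (c n * exp (- \<alpha> * lam n * t powr p)) \<le> C * (c n * lam n powr (- 1 / p))"
      using c[of n] by (simp add: mult_ac)
  qed
  show "summable (\<lambda>n. C * (c n * lam n powr (- 1 / p)))"
    by (rule summable_mult[OF sm])
qed

text \<open>The moments are computed term by term, which nonnegativity permits. The weight is given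
  by the series only for t > 0, since at 0 the series may diverge; there only its sign is
  prescribed. Zero coefficients are allowed, so that single exponentials are covered.\<close>

lemma exp_sum_weight:
  fixes c lam :: "nat \<Rightarrow> real" and \<alpha> p :: real
  assumes \<alpha>: "\<alpha> > 0" and p: "p > 0" and lam: "\<And>n. lam n > 0" and c: "\<And>n. c n \<ge> 0"
    and sm: "\<And>k. summable (\<lambda>n. c n * lam n powr (- (real k + 1) / p))"
    and pos: "(\<Sum>n. c n * lam n powr (- 1 / p)) > 0"
    and W0: "W 0 \<ge> 0" and W: "\<And>t. t > 0 \<Longrightarrow> W t = (\<Sum>n. c n * exp (- \<alpha> * lam n * t powr p))"
  shows "radial_weight W"
    and "moment W k = Gamma ((real k + 1) / p) / p * \<alpha> powr (- (real k + 1) / p) *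
      (\<Sum>n. c n * lam n powr (- (real k + 1) / p))"
proof -
  define M where "M k = Gamma ((real k + 1) / p) / p * \<alpha> powr (- (real k + 1) / p) *
      (\<Sum>n. c n * lam n powr (- (real k + 1) / p))" for k
  have G: "Gamma ((real k + 1) / p) / p * \<alpha> powr (- (real k + 1) / p) > 0" for k
    using \<alpha> p by (simp add: Gamma_real_pos)
  have Spos: "c n * lam n powr (- (real k + 1) / p) \<ge> 0" for k n using c[of n] by simp
  have M0: "M k \<ge> 0" for k
    unfolding M_def by (intro mult_nonneg_nonneg less_imp_le[OF G] suminf_nonneg sm Spos)
  have psm: "summable (\<lambda>n. c n * exp (- \<alpha> * lam n * t powr p))" if "t > 0" for t
    using sm[of 0] by (intro exp_sum_summable[OF \<alpha> p lam c _ that]) simp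
  have Wnn: "W t \<ge> 0" if "t \<ge> 0" for t
  proof (cases "t = 0")
    case False
    then have t: "t > 0" using that by simp
    show ?thesis unfolding W[OF t] using c by (intro suminf_nonneg psm[OF t]) auto
  qed (use W0 in simp)
  \<comment> \<open>A Borel function on the whole line that agrees with \<open>W\<close> on the
    half-line t >= 0; its values at negative t carry no meaning.\<close>
  define V where "V t = (if t = 0 then W 0 else \<Sum>n. c n * exp (- \<alpha> * lam n * t powr p))" for t
  have [measurable]: "V \<in> borel_measurable borel"
    unfolding V_def by measurable
  have WV: "W t = V t" if "t \<ge> 0" for t
    using that W by (auto simp: V_def)
  have indW: "(\<lambda>t. indicator {0..} t *\<^sub>R (t ^ k * W t)) = (\<lambda>t. indicator {0..} t *\<^sub>R (t ^ k * V t))" for k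
    using WV by (auto simp: fun_eq_iff split: split_indicator)
  have meas: "(\<lambda>t. indicator {0..} t *\<^sub>R (t ^ k * W t)) \<in> borel_measurable lebesgue" for k
    unfolding indW by (rule measurable_completion) measurable
  have nn: "indicator {0..} t *\<^sub>R (t ^ k * W t) \<ge> 0" for t k
    using Wnn[of t] by (simp split: split_indicator)
  have int: "(\<integral>\<^sup>+t. ennreal (indicator {0..} t *\<^sub>R (t ^ k * W t)) \<partial>lebesgue) = ennreal (M k)" for k
  proof -
    have "(\<integral>\<^sup>+t. ennreal (indicator {0..} t *\<^sub>R (t ^ k * W t)) \<partial>lebesgue)
      = (\<integral>\<^sup>+t. (\<Sum>n. ennreal (c n) * (indicator {0..} t * ennreal (t ^ k * exp (- (\<alpha> * lam n) * t powr p)))) \<partial>lborel)"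
      unfolding nn_integral_completion
    proof (rule nn_integral_cong_AE, rule eventually_mono[OF AE_lborel_singleton[of "0::real"]])
      \<comment> \<open>The single point 0, where the series need not converge, is left out as a
        null set.\<close>
      fix t :: real assume t0: "t \<noteq> 0"
      show "ennreal (indicator {0..} t *\<^sub>R (t ^ k * W t)) =
        (\<Sum>n. ennreal (c n) * (indicator {0..} t * ennreal (t ^ k * exp (- (\<alpha> * lam n) * t powr p))))"
      proof (cases "t > 0")
        case True
        have "t ^ k * W t = (\<Sum>n. t ^ k * (c n * exp (- \<alpha> * lam n * t powr p)))"
          unfolding W[OF True] by (rule suminf_mult[OF psm[OF True], symmetric])
        also have "ennreal \<dots> = (\<Sum>n. ennreal (t ^ k * (c n * exp (- \<alpha> * lam n * t powr p))))"
          using True c by (intro suminf_ennreal2[symmetric] summable_mult psm) auto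
        also have "\<dots> = (\<Sum>n. ennreal (c n) * ennreal (t ^ k * exp (- (\<alpha> * lam n) * t powr p)))"
          using True c by (intro suminf_cong) (simp add: mult_ac flip: ennreal_mult')
        finally show ?thesis using True by simp
      qed (use t0 in \<open>simp split: split_indicator\<close>)
    qed
    also have "\<dots> = (\<Sum>n. ennreal (c n) * (\<integral>\<^sup>+t. indicator {0..} t * ennreal (t ^ k * exp (- (\<alpha> * lam n) * t powr p)) \<partial>lborel))"
      by (subst nn_integral_suminf, measurable) (simp add: nn_integral_cmult)
    also have "\<dots> = (\<Sum>n. ennreal (Gamma ((real k + 1) / p) / p * \<alpha> powr (- (real k + 1) / p) * (c n * lam n powr (- (real k + 1) / p))))"
    proof (rule suminf_cong)
      fix n
      have "\<alpha> * lam n > 0" using \<alpha> lam by simp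
      from nn_integral_power_times_exp[OF p this, of k]
      show "ennreal (c n) * (\<integral>\<^sup>+t. indicator {0..} t * ennreal (t ^ k * exp (- (\<alpha> * lam n) * t powr p)) \<partial>lborel)
        = ennreal (Gamma ((real k + 1) / p) / p * \<alpha> powr (- (real k + 1) / p) * (c n * lam n powr (- (real k + 1) / p)))"
        using \<alpha> lam[of n] c[of n] by (simp add: powr_mult mult_ac flip: ennreal_mult')
    qed
    also have "\<dots> = ennreal (M k)"
      unfolding M_def suminf_mult[OF sm, symmetric]
      by (intro suminf_ennreal2 summable_mult sm mult_nonneg_nonneg less_imp_le[OF G] Spos)
    finally show ?thesis .
  qed
  have si: "set_integrable lebesgue {0..} (\<lambda>t. t ^ k * W t)" for k
    unfolding set_integrable_def
    by (rule integrableI_nn_integral_finite[OF meas AE_I2[OF nn] int])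
  have mom: "moment W k = M k" for k
    unfolding moment_def set_lebesgue_integral_def
    by (subst integral_eq_nn_integral[OF meas AE_I2[OF nn]]) (simp only: int M0 enn2real_ennreal)
  then show "moment W k = Gamma ((real k + 1) / p) / p * \<alpha> powr (- (real k + 1) / p) *
      (\<Sum>n. c n * lam n powr (- (real k + 1) / p))"
    by (simp add: M_def)
  show "radial_weight W"
    unfolding radial_weight_def
  proof (intro conjI allI impI si Wnn)
    show "W \<in> borel_measurable (lebesgue_on {0..})"
      using meas[of 0] by (subst borel_measurable_restrict_space_iff) auto
    show "\<not> (AE t in lebesgue_on {0..}. W t = 0)"
    proof
      assume "AE t in lebesgue_on {0..}. W t = 0"
      then have "AE t in lebesgue. t \<in> {0..} \<longrightarrow> W t = 0"
        by (subst (asm) AE_restrict_space_iff) auto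
      then have "AE t in lebesgue. indicator {0..} t *\<^sub>R (t ^ 0 * W t) = 0"
        by eventually_elim (simp split: split_indicator)
      then have "moment W 0 = 0"
        unfolding moment_def set_lebesgue_integral_def by (rule integral_eq_zero_AE)
      moreover have "M 0 > 0" unfolding M_def using pos by (intro mult_pos_pos[OF G[of 0]]) simp
      ultimately show False unfolding mom by simp
    qed
  qed
qed

lemma korenblum_radius_exp_sum:
  fixes c lam :: "nat \<Rightarrow> real" and \<alpha> p :: real
  assumes \<alpha>: "\<alpha> > 0" and p: "p > 0" and lam: "\<And>n. lam n > 0" and c: "\<And>n. c n \<ge> 0"
    and sm: "\<And>k. summable (\<lambda>n. c n * lam n powr (- (real k + 1) / p))"
    and pos: "(\<Sum>n. c n * lam n powr (- 1 / p)) > 0"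
    and W0: "W 0 \<ge> 0" and W: "\<And>t. t > 0 \<Longrightarrow> W t = (\<Sum>n. c n * exp (- \<alpha> * lam n * t powr p))"
  shows "radial_weight W"
    and "korenblum_radius W = ennreal (sqrt (\<alpha> powr (- 1 / p) * (Gamma (2 / p) / Gamma (1 / p)) *
      ((\<Sum>n. c n * lam n powr (- 2 / p)) / (\<Sum>n. c n * lam n powr (- 1 / p)))))"
    and "admissible_radius W (enn2real (korenblum_radius W))"
proof -
  note esw = exp_sum_weight[OF \<alpha> p lam c sm pos W0 W]
  show rw: "radial_weight W" using esw(1) .
  have "moment W 1 / moment W 0 = (Gamma (2 / p) / p * \<alpha> powr (- 2 / p) * (\<Sum>n. c n * lam n powr (- 2 / p))) /
     (Gamma (1 / p) / p * \<alpha> powr (- 1 / p) * (\<Sum>n. c n * lam n powr (- 1 / p)))"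
    using esw(2)[of 1] esw(2)[of 0] by (simp add: add.commute)
  also have "\<alpha> powr (- 2 / p) = \<alpha> powr (- 1 / p) * \<alpha> powr (- 1 / p)"
    by (simp flip: powr_add add: add_divide_distrib[symmetric])
  also have "(Gamma (2 / p) / p * (\<alpha> powr (- 1 / p) * \<alpha> powr (- 1 / p)) * (\<Sum>n. c n * lam n powr (- 2 / p))) /
     (Gamma (1 / p) / p * \<alpha> powr (- 1 / p) * (\<Sum>n. c n * lam n powr (- 1 / p)))
     = \<alpha> powr (- 1 / p) * (Gamma (2 / p) / Gamma (1 / p)) *
      ((\<Sum>n. c n * lam n powr (- 2 / p)) / (\<Sum>n. c n * lam n powr (- 1 / p)))"
    using \<alpha> p by (simp add: field_simps)
  finally have ratio: "moment W 1 / moment W 0 = \<dots>" .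
  show "korenblum_radius W = ennreal (sqrt (\<alpha> powr (- 1 / p) * (Gamma (2 / p) / Gamma (1 / p)) *
      ((\<Sum>n. c n * lam n powr (- 2 / p)) / (\<Sum>n. c n * lam n powr (- 1 / p)))))"
    using korenblum_radius_eq(1)[OF rw] unfolding ratio .
  have "enn2real (korenblum_radius W) = sqrt (moment W 1 / moment W 0)"
    unfolding korenblum_radius_eq(1)[OF rw] using moment_nonneg[OF rw] by simp
  then show "admissible_radius W (enn2real (korenblum_radius W))"
    using korenblum_radius_eq(2)[OF rw] by simp
qed

lemma korenblum_radius_exp:
  fixes c \<beta> p :: real
  assumes \<beta>: "\<beta> > 0" and p: "p > 0" and c: "c > 0"
    and W: "\<And>t. t \<ge> 0 \<Longrightarrow> W t = c * exp (- \<beta> * t powr p)"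
  shows "korenblum_radius W = ennreal (sqrt (\<beta> powr (- 1 / p) * (Gamma (2 / p) / Gamma (1 / p))))"
proof -
  \<comment> \<open>The single exponential is a series with one nonzero coefficient: \<beta> takes
    the place of \<alpha>, all exponents \<open>lam n\<close> are 1, and \<open>c\<close> cancels in
    the ratio of the two sums.\<close>
  define c' where "c' n = (if n = 0 then c else 0)" for n :: nat
  have sums: "(\<lambda>n. c' n * x) sums (c * x)" for x
    using sums_single[of 0 "\<lambda>_. c * x"] unfolding c'_def
    by (rule sums_cong[THEN iffD1, rotated]) auto
  have c': "c' n \<ge> 0" for n using c by (simp add: c'_def)
  have W': "W t = (\<Sum>n. c' n * exp (- \<beta> * 1 * t powr p))" if "t > 0" for t
    using that W[of t] sums_unique[OF sums] by simp
  have "W 0 \<ge> 0" using W[of 0] c by simp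
  then have "korenblum_radius W = ennreal (sqrt (\<beta> powr (- 1 / p) * (Gamma (2 / p) / Gamma (1 / p)) *
      ((\<Sum>n. c' n * 1 powr (- 2 / p)) / (\<Sum>n. c' n * 1 powr (- 1 / p)))))"
    using c c' sums_unique[OF sums, of 1] sums_summable[OF sums, of 1]
    by (intro korenblum_radius_exp_sum(2)[OF \<beta> p, where c = c' and lam = "\<lambda>_. 1"] W') simp_all
  moreover have "(\<Sum>n. c' n * 1 powr x) = c" for x :: real
    using sums_unique[OF sums, of 1] by simp
  ultimately show ?thesis using c by simp
qed

section \<open>Series indexed from one and the sum of inverse fourth powers\<close>

text \<open>For nonnegative terms unconditional and ordinary summation agree, so the sums over
  \<open>{1..}\<close> become series over all naturals after an index shift.\<close>

lemma infsum_from_1: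
  fixes f :: "nat \<Rightarrow> real"
  assumes nn: "\<And>n. n \<ge> 1 \<Longrightarrow> f n \<ge> 0" and sm: "summable (\<lambda>n. f (Suc n))"
  shows "infsum f {1..} = (\<Sum>n. f (Suc n))"
proof -
  have "((\<lambda>n. f (Suc n)) has_sum (\<Sum>n. f (Suc n))) UNIV"
    using sm nn by (intro sums_nonneg_imp_has_sum summable_sums) auto
  then have "(f has_sum (\<Sum>n. f (Suc n))) (Suc ` UNIV)"
    by (subst has_sum_reindex) (auto simp: o_def)
  also have "Suc ` UNIV = {1..}"
    by (auto simp: image_iff) (metis Suc_le_D)
  finally show ?thesis by (rule infsumI)
qed

lemma summable_on_from_1_iff:
  fixes f :: "nat \<Rightarrow> real"
  assumes nn: "\<And>n. n \<ge> 1 \<Longrightarrow> f n \<ge> 0"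
  shows "f summable_on {1..} \<longleftrightarrow> summable (\<lambda>n. f (Suc n))"
proof -
  have "Suc ` UNIV = {1..}"
    by (auto simp: image_iff) (metis Suc_le_D)
  then have "f summable_on {1..} \<longleftrightarrow> (f \<circ> Suc) summable_on UNIV"
    using summable_on_reindex[of Suc UNIV f] by simp
  also have "\<dots> \<longleftrightarrow> summable (\<lambda>n. f (Suc n))"
    using nn by (subst summable_on_UNIV_nonneg_real_iff) (auto simp: o_def)
  finally show ?thesis .
qed

text \<open>This is the complex sine product at i x, multiplied by -i, since sin (i y) = i sinh
  y.\<close>

lemma sinh_product_formula_real:
  "(\<lambda>n. pi * x * (\<Prod>k=1..n. 1 + x\<^sup>2 / (real k)\<^sup>2)) \<longlonglongrightarrow> sinh (pi * x)"
proof -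
  have "(\<lambda>n. - \<i> * (of_real pi * (\<i> * of_real x) * (\<Prod>k=1..n. 1 - (\<i> * of_real x)\<^sup>2 / (of_nat k)\<^sup>2)))
      \<longlonglongrightarrow> - \<i> * sin (of_real pi * (\<i> * of_real x))"
    by (intro tendsto_mult tendsto_const sin_product_formula_complex)
  also have "(\<lambda>n. - \<i> * (of_real pi * (\<i> * of_real x) * (\<Prod>k=1..n. 1 - (\<i> * of_real x)\<^sup>2 / (of_nat k)\<^sup>2)))
      = (\<lambda>n. complex_of_real (pi * x * (\<Prod>k=1..n. 1 + x\<^sup>2 / (real k)\<^sup>2)))"
    by (simp add: power_mult_distrib algebra_simps)
  also have "- \<i> * sin (of_real pi * (\<i> * of_real x)) = sinh (complex_of_real (pi * x))"
    by (simp add: sinh_conv_sin mult_ac)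
  also have "\<dots> = of_real (sinh (pi * x))"
    by (simp add: sinh_field_def flip: exp_of_real)
  finally show ?thesis by (subst (asm) tendsto_of_real_iff)
qed

text \<open>Telescoping the partial products \<open>P x n\<close> gives x^4 f(x) = 1 - lim P, so
  \<open>f\<close> has the closed form \<open>g\<close> away from 0, while f(0) is the wanted sum.
  Continuity of \<open>f\<close> at 0 then reduces the claim to the limit of
  \<open>g\<close>.\<close>

lemma inverse_fourth_powers_sums: "(\<lambda>n. 1 / (real (Suc n)) ^ 4) sums (pi ^ 4 / 90)"
proof -
  define P where "P x n = (\<Prod>k=1..n. 1 - x ^ 4 / real k ^ 4)" for x :: real and n
  define f where "f x = (\<Sum>n. P x n / real (Suc n) ^ 4)" for x
  define g where "g x = (1 - sin (pi * x) * sinh (pi * x) / (pi * x)\<^sup>2) / x ^ 4" for x :: real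
  have smb: "summable (\<lambda>n. 1 / real (Suc n) ^ 4)"
    using inverse_power_summable[of 4, where 'a = real]
    by (subst summable_Suc_iff) (simp add: inverse_eq_divide)
  have f0: "f 0 = (\<Sum>n. 1 / real (Suc n) ^ 4)"
    by (simp add: f_def P_def)
  have lim: "P x \<longlonglongrightarrow> sin (pi * x) * sinh (pi * x) / (pi * x)\<^sup>2" if x: "x \<noteq> 0" for x
  proof -
    have "(\<lambda>n. (pi * x * (\<Prod>k=1..n. 1 - x\<^sup>2 / of_nat k^2)) * (pi * x * (\<Prod>k=1..n. 1 + x\<^sup>2 / (real k)\<^sup>2)) / (pi * x)\<^sup>2)
        \<longlonglongrightarrow> sin (pi * x) * sinh (pi * x) / (pi * x)\<^sup>2"
      by (intro tendsto_intros sin_product_formula_real sinh_product_formula_real) (use x in auto)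
    also have "(\<lambda>n. (pi * x * (\<Prod>k=1..n. 1 - x\<^sup>2 / of_nat k^2)) * (pi * x * (\<Prod>k=1..n. 1 + x\<^sup>2 / (real k)\<^sup>2)) / (pi * x)\<^sup>2)
       = (\<lambda>n. (\<Prod>k=1..n. (1 - x\<^sup>2 / of_nat k^2) * (1 + x\<^sup>2 / (real k)\<^sup>2)))"
      using x by (simp add: prod.distrib power2_eq_square)
    also have "\<dots> = P x"
    proof -
      have "(1 - a) * (1 + a) = 1 - a\<^sup>2" for a :: real by (simp add: power2_eq_square algebra_simps)
      then show ?thesis unfolding P_def by (simp add: power_divide)
    qed
    finally show ?thesis .
  qed
  have fg: "f x = g x" if x: "x \<noteq> 0" for x
  proof -
    have "(\<lambda>n. P x n - P x (Suc n)) sums (P x 0 - sin (pi * x) * sinh (pi * x) / (pi * x)\<^sup>2)"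
      by (rule telescope_sums'[OF lim[OF x]])
    also have "(\<lambda>n. P x n - P x (Suc n)) = (\<lambda>n. x ^ 4 / real (Suc n) ^ 4 * P x n)"
      unfolding P_def by (simp add: prod.nat_ivl_Suc' algebra_simps)
    also have "P x 0 = 1" by (simp add: P_def)
    finally have "(\<lambda>n. x ^ 4 / real (Suc n) ^ 4 * P x n) sums (1 - sin (pi * x) * sinh (pi * x) / (pi * x)\<^sup>2)" .
    from sums_divide[OF this, of "x ^ 4"] x have "(\<lambda>n. P x n / real (Suc n) ^ 4) sums g x"
      unfolding g_def by simp
    then show ?thesis by (simp add: f_def sums_iff)
  qed
  \<comment> \<open>For |x| < 1 every factor 1 - x^4/k^4 lies between 0 and 1, so the terms are
    dominated by 1/(n + 1)^4 uniformly in x.\<close>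
  have "continuous_on (ball 0 1) f"
  proof (rule uniform_limit_theorem)
    show "uniform_limit (ball 0 1) (\<lambda>n x. \<Sum>k<n. P x k / real (Suc k) ^ 4) f sequentially"
      unfolding f_def
    proof (rule Weierstrass_m_test[OF _ smb])
      fix n :: nat and x :: real assume x: "x \<in> ball 0 1"
      have "\<bar>1 - x ^ 4 / real k ^ 4\<bar> \<le> 1" if "k \<ge> 1" for k
      proof -
        have "x ^ 4 = \<bar>x\<bar> ^ 4" by simp
        also have "\<dots> \<le> 1" using x by (intro power_le_one) auto
        also have "1 \<le> real k ^ 4" using that by simp
        finally have "x ^ 4 / real k ^ 4 \<le> 1" using that by simp
        moreover have "0 \<le> x ^ 4 / real k ^ 4" by simp
        ultimately show ?thesis by linarith
      qed
      then have "(\<Prod>k=1..n. \<bar>1 - x ^ 4 / real k ^ 4\<bar>) \<le> (\<Prod>k=1..n. 1)" by (intro prod_mono) auto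
      then show "norm (P x n / real (Suc n) ^ 4) \<le> 1 / real (Suc n) ^ 4"
        unfolding P_def by (simp add: abs_prod divide_right_mono del: of_nat_Suc)
    qed
  qed (auto simp: P_def intro!: continuous_intros always_eventually)
  then have "isCont f 0" by (subst (asm) continuous_on_eq_continuous_at) auto
  then have "f \<midarrow>0\<rightarrow> f 0" by (simp add: isCont_def)
  moreover have "f \<midarrow>0\<rightarrow> pi ^ 4 / 90"
  proof (rule Lim_transform_eventually)
    \<comment> \<open>Here sin y sinh y = y^2 - y^6/90 + ..., the terms of order y^4
      cancelling.\<close>
    have "(\<lambda>y::real. (1 - sin y * sinh y / y\<^sup>2) / y ^ 4) \<midarrow>0\<rightarrow> 1 / 90"
      unfolding sinh_field_def by real_asymp
    moreover have "filterlim (\<lambda>x. pi * x) (at 0) (at 0)"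
      by real_asymp
    ultimately have "(\<lambda>x. pi ^ 4 * ((1 - sin (pi * x) * sinh (pi * x) / (pi * x)\<^sup>2) / (pi * x) ^ 4)) \<midarrow>0\<rightarrow> pi ^ 4 * (1 / 90)"
      by (intro tendsto_mult tendsto_const) (rule filterlim_compose)
    then show "g \<midarrow>0\<rightarrow> pi ^ 4 / 90"
      by (simp add: g_def[abs_def] power_mult_distrib)
    show "\<forall>\<^sub>F x in at 0. g x = f x"
      using fg by (auto simp: eventually_at_filter)
  qed
  ultimately have "f 0 = pi ^ 4 / 90" by (rule LIM_unique)
  then show ?thesis using smb f0 by (simp add: sums_iff)
qed

section \<open>The weight of the theorem: formula, strict comparison with the first exponential, and
  the special case\<close>

theorem mainTheorem11:
  fixes \<alpha> m :: real and lam :: "nat \<Rightarrow> real" and d :: "nat \<Rightarrow> complex"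
    and W W\<^sub>1 W\<^sub>0 :: "real \<Rightarrow> real"
  assumes "\<alpha> > 0" and "m > 0"
    and "mono_on {1..} lam"
    and "\<forall>n\<ge>1. lam n > 0"
    and "filterlim lam at_top sequentially"
    and "\<forall>n\<ge>1. d n \<noteq> 0"
    and "(\<lambda>n. cmod (d n) * lam n powr (- 2 / m)) summable_on {1..}"
    and "\<forall>z::complex. W ((cmod z)\<^sup>2) =
           (\<Sum>\<^sub>\<infinity>n\<in>{1..}. cmod (d n) * exp (- \<alpha> * lam n * cmod z powr m))"
    and "\<forall>z::complex. W\<^sub>1 ((cmod z)\<^sup>2) = cmod (d 1) * exp (- \<alpha> * lam 1 * cmod z powr m)"
    and "\<forall>z::complex. W\<^sub>0 ((cmod z)\<^sup>2) = exp (- \<alpha> * cmod z powr m)"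
  shows "radial_weight W \<and>
    (korenblum_radius W)\<^sup>2 =
      ennreal (\<alpha> powr (- 2 / m) * (Gamma (4 / m) / Gamma (2 / m)) *
        ((\<Sum>\<^sub>\<infinity>n\<in>{1..}. cmod (d n) * lam n powr (- 4 / m)) /
         (\<Sum>\<^sub>\<infinity>n\<in>{1..}. cmod (d n) * lam n powr (- 2 / m)))) \<and>
    admissible_radius W (enn2real (korenblum_radius W)) \<and>
    korenblum_radius W < korenblum_radius W\<^sub>1 \<and>
    ((\<forall>n\<ge>1. lam n = real n powr m \<and> d n = 1) \<longrightarrow>
       korenblum_radius W = ennreal (pi / sqrt 15) * korenblum_radius W\<^sub>0)"
proof -
  \<comment> \<open>The weight is a function of t = |z|^2, so |z|^m = t^p. The sequences are shifted
    to start at index 0.\<close>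
  define p where "p = m / 2"
  define c l where "c n = cmod (d (Suc n))" and "l n = lam (Suc n)" for n
  have p: "p > 0" and ep: "2 / m = 1 / p" "4 / m = 2 / p" "- 2 / m = - 1 / p" "- 4 / m = - 2 / p"
    using assms(2) by (auto simp: p_def)
  note \<alpha> = assms(1)
  have c: "c n > 0" for n using assms(6) by (simp add: c_def)
  have l: "l n > 0" for n using assms(4) by (simp add: l_def)
  have l0: "l 0 \<le> l n" for n
    using monotone_onD[OF assms(3), of 1 "Suc n"] by (simp add: l_def)
  have sm0: "summable (\<lambda>n. c n * l n powr (- 1 / p))"
    using assms(7) unfolding ep c_def l_def by (subst (asm) summable_on_from_1_iff) auto
  \<comment> \<open>As \<open>l n\<close> is bounded below by \<open>l 0\<close> > 0, each further
    negative power costs at most a constant factor, so the hypothesis bounds all moments.\<close>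
  have sm: "summable (\<lambda>n. c n * l n powr (- (real k + 1) / p))" for k
  proof (rule summable_comparison_test)
    show "\<exists>N. \<forall>n\<ge>N. norm (c n * l n powr (- (real k + 1) / p)) \<le> l 0 powr (- real k / p) * (c n * l n powr (- 1 / p))"
    proof (intro exI allI impI)
      fix n
      have "l n powr (- (real k + 1) / p) = l n powr (- real k / p) * l n powr (- 1 / p)"
        by (simp flip: powr_add add: add_divide_distrib diff_divide_distrib)
      also have "l n powr (- real k / p) \<le> l 0 powr (- real k / p)"
        using l[of 0] l0[of n] p by (intro powr_mono2') auto
      finally have "c n * l n powr (- (real k + 1) / p) \<le> c n * (l 0 powr (- real k / p) * l n powr (- 1 / p))"
        using c[of n] by (simp add: mult_right_mono)
      then show "norm (c n * l n powr (- (real k + 1) / p)) \<le> l 0 powr (- real k / p) * (c n * l n powr (- 1 / p))"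
        using c[of n] by (simp add: mult_ac)
    qed
  qed (intro summable_mult sm0)
  have radial: "\<exists>z::complex. (cmod z)\<^sup>2 = t \<and> cmod z powr m = t powr p" if "t \<ge> 0" for t
  proof -
    have "sqrt t powr m = t powr p"
      using that by (simp add: p_def powr_powr flip: powr_half_sqrt)
    then show ?thesis using that by (intro exI[of _ "of_real (sqrt t)"]) simp
  qed
  have W_inf: "W t = (\<Sum>\<^sub>\<infinity>n\<in>{1..}. cmod (d n) * exp (- \<alpha> * lam n * t powr p))" if "t \<ge> 0" for t
    using radial[OF that] assms(8) by metis
  have W1: "W\<^sub>1 t = cmod (d 1) * exp (- (\<alpha> * lam 1) * t powr p)" if "t \<ge> 0" for t
    using radial[OF that] assms(9) by (metis mult_minus_left)
  have W0: "W\<^sub>0 t = 1 * exp (- \<alpha> * t powr p)" if "t \<ge> 0" for t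
    using radial[OF that] assms(10) by (metis mult_1)
  have W: "W t = (\<Sum>n. c n * exp (- \<alpha> * l n * t powr p))" if t: "t > 0" for t
  proof -
    have "summable (\<lambda>n. c n * exp (- \<alpha> * l n * t powr p))"
      using exp_sum_summable[OF \<alpha> p l _ sm0 t] c by (simp add: less_imp_le)
    then show ?thesis
      unfolding W_inf[OF less_imp_le[OF t]] c_def l_def by (subst infsum_from_1) auto
  qed
  \<comment> \<open>At t = 0 the terms are the \<open>cmod (d n)\<close>, which need not be
    summable; \<open>infsum\<close> then has the value 0, so the sign is right in either
    case.\<close>
  have "W 0 \<ge> 0" unfolding W_inf[OF order_refl] by (intro infsum_nonneg) simp
  define S2 S4 where "S2 = (\<Sum>n. c n * l n powr (- 1 / p))" and "S4 = (\<Sum>n. c n * l n powr (- 2 / p))"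
  have sm1: "summable (\<lambda>n. c n * l n powr (- 2 / p))" using sm[of 1] by (simp add: add.commute)
  have S2: "S2 > 0" unfolding S2_def by (intro suminf_pos sm0 mult_pos_pos c) (use l in \<open>simp add: less_imp_neq[symmetric]\<close>)
  have S4: "S4 > 0" unfolding S4_def by (intro suminf_pos sm1 mult_pos_pos c) (use l in \<open>simp add: less_imp_neq[symmetric]\<close>)
  define K where "K = \<alpha> powr (- 1 / p) * (Gamma (2 / p) / Gamma (1 / p))"
  have K: "K > 0" using \<alpha> p by (simp add: K_def Gamma_real_pos)
  have kor: "radial_weight W" "korenblum_radius W = ennreal (sqrt (K * (S4 / S2)))"
    "admissible_radius W (enn2real (korenblum_radius W))"
    unfolding K_def S2_def S4_def
    by (rule korenblum_radius_exp_sum[OF \<alpha> p l less_imp_le[OF c] sm S2[unfolded S2_def] \<open>W 0 \<ge> 0\<close> W]; assumption)+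
  have sums_eq: "(\<Sum>\<^sub>\<infinity>n\<in>{1..}. cmod (d n) * lam n powr (- 1 / p)) = S2"
    "(\<Sum>\<^sub>\<infinity>n\<in>{1..}. cmod (d n) * lam n powr (- 2 / p)) = S4"
    unfolding S2_def S4_def c_def l_def
    using sm0 sm1 by (subst infsum_from_1; simp add: c_def l_def)+
  have sq: "(korenblum_radius W)\<^sup>2 = ennreal (K * (S4 / S2))"
    unfolding kor(2) using K S2 S4 by (simp add: ennreal_power)
  \<comment> \<open>\<open>S4\<close> comes from \<open>S2\<close> by multiplying each term by
    l_n^(-1/p), which is at most its value at n = 0. Since \<open>lam\<close> may repeat its first
    value, strictness comes from its divergence, which yields some \<open>l N\<close> >
    \<open>l 0\<close>.\<close>
  have lt: "S4 < l 0 powr (- 1 / p) * S2"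
  proof -
    obtain N where N: "l N > l 0"
    proof -
      have "\<forall>\<^sub>F n in sequentially. lam n > l 0"
        using assms(5) by (simp add: filterlim_at_top_dense)
      then obtain N where "\<And>n. n \<ge> N \<Longrightarrow> lam n > l 0" by (auto simp: eventually_sequentially)
      then show ?thesis using that[of N] by (simp add: l_def)
    qed
    have split: "l n powr (- 2 / p) = l n powr (- 1 / p) * l n powr (- 1 / p)" for n
      by (simp flip: powr_add add: add_divide_distrib[symmetric])
    define e where "e n = l 0 powr (- 1 / p) * (c n * l n powr (- 1 / p)) - c n * l n powr (- 2 / p)" for n
    have e: "e n = c n * l n powr (- 1 / p) * (l 0 powr (- 1 / p) - l n powr (- 1 / p))" for n
      unfolding e_def split by (simp add: algebra_simps)
    have "summable e" unfolding e_def by (intro summable_diff summable_mult sm0 sm1)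
    moreover have "e n \<ge> 0" for n
    proof -
      have "l n powr (- 1 / p) \<le> l 0 powr (- 1 / p)"
        using l[of 0] l0[of n] p by (intro powr_mono2') auto
      then show ?thesis unfolding e using c[of n] by simp
    qed
    moreover have "e N > 0"
    proof -
      have "l N powr (- 1 / p) < l 0 powr (- 1 / p)"
        using l[of 0] N p by (intro powr_less_mono2_neg) auto
      then show ?thesis unfolding e using c[of N] l[of N] by simp
    qed
    ultimately have "0 < suminf e" by (rule suminf_pos2)
    also have "suminf e = l 0 powr (- 1 / p) * S2 - S4"
      unfolding e_def S2_def S4_def suminf_mult[OF sm0, symmetric]
      by (rule suminf_diff[OF summable_mult[OF sm0] sm1, symmetric])
    finally show ?thesis by simp
  qed
  \<comment> \<open>\<open>W\<^sub>1\<close> is one exponential of rate \<alpha>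
    \<open>lam 1\<close>; its radius has \<open>l 0 powr (- 1 / p)\<close> where that of
    \<open>W\<close> has the weighted mean \<open>S4 / S2\<close>.\<close>
  have kor1: "korenblum_radius W\<^sub>1 = ennreal (sqrt (l 0 powr (- 1 / p) * K))"
  proof -
    have "korenblum_radius W\<^sub>1 = ennreal (sqrt ((\<alpha> * lam 1) powr (- 1 / p) * (Gamma (2 / p) / Gamma (1 / p))))"
      using \<alpha> p l[of 0] c[of 0] by (intro korenblum_radius_exp[where c = "cmod (d 1)"] W1) (auto simp: l_def c_def)
    also have "(\<alpha> * lam 1) powr (- 1 / p) * (Gamma (2 / p) / Gamma (1 / p)) = l 0 powr (- 1 / p) * K"
      using \<alpha> l[of 0] by (simp add: powr_mult l_def K_def)
    finally show ?thesis .
  qed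
  have less: "korenblum_radius W < korenblum_radius W\<^sub>1"
  proof -
    have "S4 / S2 < l 0 powr (- 1 / p)" using lt S2 by (simp add: field_simps)
    then have "K * (S4 / S2) < K * l 0 powr (- 1 / p)" by (rule mult_strict_left_mono[OF _ K])
    then have "K * (S4 / S2) < l 0 powr (- 1 / p) * K" by (simp only: mult.commute)
    then show ?thesis
      unfolding kor(2) kor1 using K S2 S4 l[of 0] by (intro ennreal_lessI real_sqrt_less_mono) (auto intro!: mult_pos_pos)
  qed
  have special: "korenblum_radius W = ennreal (pi / sqrt 15) * korenblum_radius W\<^sub>0"
    if sp: "\<forall>n\<ge>1. lam n = real n powr m \<and> d n = 1"
  proof -
    have ln: "l n powr (- 1 / p) = 1 / (real (Suc n))\<^sup>2" "l n powr (- 2 / p) = 1 / (real (Suc n)) ^ 4" for n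
    proof -
      have "l n = real (Suc n) powr m" using sp by (simp add: l_def)
      then have "l n powr (- 1 / p) = real (Suc n) powr (- 2)" "l n powr (- 2 / p) = real (Suc n) powr (- 4)"
        using assms(2) by (simp_all add: powr_powr p_def)
      then show "l n powr (- 1 / p) = 1 / (real (Suc n))\<^sup>2" "l n powr (- 2 / p) = 1 / (real (Suc n)) ^ 4"
        by (simp_all add: powr_minus inverse_eq_divide del: of_nat_Suc)
    qed
    have cn: "c n = 1" for n using sp by (simp add: c_def)
    have S2': "S2 = pi\<^sup>2 / 6"
      unfolding S2_def cn ln using inverse_squares_sums by (simp add: sums_iff add.commute)
    have S4': "S4 = pi ^ 4 / 90"
      unfolding S4_def cn ln using inverse_fourth_powers_sums by (simp add: sums_iff)
    \<comment> \<open>The two sums are now zeta(2) and zeta(4), and \<open>K\<close> is the squared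
      radius for the single exponential of rate \<alpha>.\<close>
    have ratio: "S4 / S2 = pi\<^sup>2 / 15"
      unfolding S2' S4' by (simp add: power4_eq_xxxx power2_eq_square)
    have "korenblum_radius W = ennreal (sqrt (K * (pi\<^sup>2 / 15)))"
      using kor(2) unfolding ratio .
    also have "sqrt (K * (pi\<^sup>2 / 15)) = pi / sqrt 15 * sqrt K"
      by (simp add: real_sqrt_mult real_sqrt_divide)
    also have "ennreal \<dots> = ennreal (pi / sqrt 15) * ennreal (sqrt K)"
      by (rule ennreal_mult) (use K in auto)
    also have "ennreal (sqrt K) = korenblum_radius W\<^sub>0"
      unfolding K_def using \<alpha> p by (intro korenblum_radius_exp[where c = 1, symmetric] W0) auto
    finally show ?thesis .
  qed
  show ?thesis
    unfolding ep sums_eq sq using kor(1,3) less special by (simp add: K_def)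
qed

end
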